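(* Let $k \geq 3$ be an integer, let $c$ be a real number with $0 \leq c < \frac{1}{k-1}$, and let $h$ be a multiplicative function such that $h(p) = c$ for every prime $p$. Then $$\sum_{n \leq x} \mu^2(n) \sum_{d \mid n} h(d) \;\leq\; (2 + o(1)) \sum_{n \leq x} \mu^2(n) \sum_{\substack{d \mid n \\ d \leq n^{1/k}}} h(d)$$ as $x \to \infty$.
   Context: $\mu$ is the Möbius function, so $\mu^2$ is the indicator function of the squarefree positive integers. Sums over $n \leq x$ run over positive integers, and sums over $d \mid n$ run over positive divisors. The function $h$ is real-valued and multiplicative: $h(1)=1$ and $h(ab)=h(a)h(b)$ whenever $\gcd(a,b)=1$. The $o(1)$ term tends to $0$ as $x \to \infty$ with $h$ and $k$ fixed. *)

theory Defs
  imports Complex_Main "HOL-Computational_Algebra.Squarefree"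
begin

definition moebius_mu :: "nat \<Rightarrow> real" where
  "moebius_mu n = (if squarefree n then (- 1) ^ card (prime_factors n) else 0)"

lemma moebius_mu_squared: "(moebius_mu n)\<^sup>2 = (if squarefree n then 1 else 0)"
  by (simp add: moebius_mu_def power_mult [symmetric] mult.commute)

(* Arithmetic functions live on the positive integers; the value h 0 is unconstrained. *)
definition multiplicative_fun :: "(nat \<Rightarrow> real) \<Rightarrow> bool" where
  "multiplicative_fun h \<longleftrightarrow>
     h 1 = 1 \<and> (\<forall>a b. a > 0 \<longrightarrow> b > 0 \<longrightarrow> coprime a b \<longrightarrow> h (a * b) = h a * h b)"

end

(*
Write w(d) = prod_{p | d} c/(p+1) and G(y) for the sum of w(d) over squarefree d <= y.
The squarefree n <= x divisible by a squarefree d number a x/d prod_{p | d} p/(p+1), with an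
error O(sqrt (x/d)) times a product over p | d that the factor c^omega(d) absorbs because
c <= 1/2.  Hence the left-hand sum is at most a x G(x) + O(x) and the sum over small divisors
is at least a x G(x^(1/k)) - O(x).  Mertens' first theorem shows that
F(u) = sum w(d) (u - ln d), the integral of g(u) = G(exp u), satisfies
(1+c) F(u) = u g(u) + O(g(u)); so g varies regularly with exponent c and G(x) / G(x^(1/k)) has
limit superior at most k^c.  As k <= 2^(k-1) and c < 1/(k-1), k^c < 2; for c > 0 also G tends
to infinity, which swallows the O(x) terms.  The error term can thus be taken to be 0.
*)

theory Submission
  imports Defs "HOL-Analysis.Analysis" "HOL-Real_Asymp.Real_Asymp"
begin

subsection \<open>Squarefree numbers\<close>

text \<open>The weight \<open>w(d)\<close> is \<open>c^omega(d)\<close> times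
  \<open>prod_{p | d} 1/(p+1)\<close>, the relative density of the multiples of \<open>d\<close>
  among the squarefree numbers. This is why exchanging the order of summation turns both sums into
  \<open>a x\<close> times a partial sum of \<open>w\<close>. For d <= x^(1/k) the condition d <=
  n^(1/k) fails only when n < d^k, which loses at most d^(k-1) multiples of each such
  \<open>d\<close> and at most \<open>x\<close> in all. The relation between \<open>F\<close> and
  \<open>g\<close> comes from u g(u) - F(u) = sum w(d) ln d. Splitting ln d over the primes of
  \<open>d\<close> and writing d = p m, Mertens' theorem turns the inner sum into c (u - ln m) +
  O(1), hence the whole into c F(u) + O(g(u)). If \<open>F' = g\<close> held everywhere, the
  relation would put F'/F between (1+c)/(u+A) and (1+c)/(u-A). So F(k u)/F(u) is k^(1+c) in the
  limit, and returning from \<open>F\<close> to \<open>g\<close> divides by \<open>k\<close>. Only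
  such ratios enter, not an asymptotic constant for \<open>G\<close>. For c = 0 the sum
  \<open>G\<close> stays at 1 and cannot absorb O(x); that case is settled directly, since only d =
  1 contributes to either sum.\<close>

lemma prod_prime_factors_squarefree:
  assumes "squarefree (n :: nat)"
  shows "\<Prod>(prime_factors n) = n"
proof -
  have n: "n > 0" using assms by (intro Nat.gr0I) auto
  have "(\<Prod>p\<in>prime_factors n. p) = (\<Prod>p\<in>prime_factors n. p ^ multiplicity p n)"
    using assms n by (intro prod.cong) (auto simp: squarefree_factorial_semiring')
  also have "\<dots> = n" using prime_factorization_nat[OF n] by simp
  finally show ?thesis .
qed

lemma ln_squarefree:
  assumes "squarefree (n :: nat)"
  shows "ln (real n) = (\<Sum>p\<in>prime_factors n. ln (real p))"
proof -
  have "ln (real n) = ln (\<Prod>p\<in>prime_factors n. real p)"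
    using arg_cong[OF prod_prime_factors_squarefree[OF assms], of real] by simp
  also have "\<dots> = (\<Sum>p\<in>prime_factors n. ln (real p))"
    by (intro ln_prod) (auto dest: in_prime_factors_imp_prime prime_gt_0_nat)
  finally show ?thesis .
qed

lemma prime_factors_prime_mult:
  assumes "prime (p :: nat)" "m > 0"
  shows "prime_factors (p * m) = insert p (prime_factors m)"
  using assms by (auto simp: prime_factors_product prime_prime_factors)

lemma squarefree_prime_mult_iff:
  assumes "prime (p :: nat)"
  shows "squarefree (p * m) \<longleftrightarrow> squarefree m \<and> \<not> p dvd m"
proof (intro iffI conjI)
  assume sf: "squarefree (p * m)"
  then show "squarefree m" by (rule squarefree_multD)
  show "\<not> p dvd m"
  proof
    assume "p dvd m"
    then have "p ^ 2 dvd p * m" by (auto simp: power2_eq_square)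
    with sf have "p dvd 1" by (rule squarefreeD)
    with assms show False by auto
  qed
next
  assume "squarefree m \<and> \<not> p dvd m"
  with assms show "squarefree (p * m)"
    by (intro squarefree_mult_coprime) (auto simp: squarefree_prime prime_imp_coprime)
qed

text \<open>The bound is real because it is applied to arguments such as x/d and x^(1/k);
  \<open>0\<close> is excluded by not being squarefree.\<close>

definition squarefree_upto :: "real \<Rightarrow> nat set" where
  "squarefree_upto y = {d. squarefree d \<and> real d \<le> y}"

lemma finite_nat_real_le: "finite {d :: nat. real d \<le> y}"
  by (rule finite_subset[of _ "{..nat \<lfloor>y\<rfloor>}"]) (auto simp: le_nat_floor)

lemma finite_squarefree_upto [simp]: "finite (squarefree_upto y)"
  by (rule finite_subset[OF _ finite_nat_real_le[of y]]) (auto simp: squarefree_upto_def)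

lemma squarefree_upto_mono: "x \<le> y \<Longrightarrow> squarefree_upto x \<subseteq> squarefree_upto y"
  by (auto simp: squarefree_upto_def)

lemma squarefree_uptoD:
  assumes "d \<in> squarefree_upto y"
  shows "squarefree d" "d > 0" "real d \<ge> 1" "real d \<le> y"
proof -
  show "squarefree d" "real d \<le> y" using assms by (auto simp: squarefree_upto_def)
  then show "d > 0" by (intro Nat.gr0I) auto
  then show "real d \<ge> 1" by simp
qed

lemma one_mem_squarefree_upto [simp]: "Suc 0 \<in> squarefree_upto y \<longleftrightarrow> y \<ge> 1"
  by (auto simp: squarefree_upto_def)

text \<open>The substitution \<open>d = p * m\<close>.\<close>

lemma sum_squarefree_prime_factors:
  fixes w v \<phi> :: "nat \<Rightarrow> real"
  assumes w: "\<And>p m. prime p \<Longrightarrow> squarefree m \<Longrightarrow> \<not> p dvd m \<Longrightarrow> w (p * m) = v p * w m"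
  shows "(\<Sum>d\<in>squarefree_upto y. w d * (\<Sum>p\<in>prime_factors d. \<phi> p)) =
    (\<Sum>m\<in>squarefree_upto y. w m *
      (\<Sum>p | prime p \<and> real p \<le> y / real m \<and> \<not> p dvd m. v p * \<phi> p))"
proof -
  let ?B = "\<lambda>m. {p. prime p \<and> real p \<le> y / real m \<and> \<not> p dvd m}"
  have finB: "finite (?B m)" for m
    by (rule finite_subset[OF _ finite_nat_real_le[of "y / real m"]]) auto
  have "(\<Sum>d\<in>squarefree_upto y. w d * (\<Sum>p\<in>prime_factors d. \<phi> p)) =
    (\<Sum>(d, p)\<in>Sigma (squarefree_upto y) prime_factors. w d * \<phi> p)"
    by (simp add: sum.Sigma sum_distrib_left)
  also have "\<dots> = (\<Sum>(m, p)\<in>Sigma (squarefree_upto y) ?B. w m * (v p * \<phi> p))"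
  proof -
    have 1: "p * (d div p) = d" "d div p \<in> squarefree_upto y" "p \<in> ?B (d div p)"
      "w d = v p * w (d div p)"
      if d: "d \<in> squarefree_upto y" and p: "p \<in> prime_factors d" for d p
    proof -
      define m where "m = d div p"
      show "p * (d div p) = d" using p by (auto dest: in_prime_factors_imp_dvd)
      then have dm: "d = p * m" by (simp add: m_def)
      have pp: "prime p" using p by auto
      have sf: "squarefree m" "\<not> p dvd m"
        using squarefree_uptoD(1)[OF d] pp by (auto simp: dm squarefree_prime_mult_iff)
      have m0: "m > 0" using sf by (intro Nat.gr0I) auto
      have "real p * real m \<le> y" using squarefree_uptoD(4)[OF d] by (simp add: dm)
      moreover have "1 * real m \<le> real p * real m"
        using prime_ge_1_nat[OF pp] by (intro mult_right_mono) auto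
      ultimately have "real m \<le> y" "real p * real m \<le> y" by linarith+
      then have "m \<in> squarefree_upto y \<and> p \<in> ?B m"
        using sf pp m0 by (auto simp: squarefree_upto_def field_simps)
      then show "d div p \<in> squarefree_upto y" "p \<in> ?B (d div p)" unfolding m_def by auto
      show "w d = v p * w (d div p)"
        unfolding m_def[symmetric] using w[OF pp sf] by (simp only: dm)
    qed
    have 2: "p * m div p = m" "p * m \<in> squarefree_upto y" "p \<in> prime_factors (p * m)"
      if m: "m \<in> squarefree_upto y" and p: "p \<in> ?B m" for m p
      using squarefree_uptoD[OF m] p
      by (auto simp: squarefree_upto_def squarefree_prime_mult_iff pos_le_divide_eq
          prime_factors_prime_mult prime_gt_0_nat)
    show ?thesis
      by (rule sum.reindex_bij_witness[of _ "\<lambda>(m, p). (p * m, p)" "\<lambda>(d, p). (d div p, p)"])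
         (use 1 2 in \<open>auto simp: mult_ac\<close>)
  qed
  also have "\<dots> = (\<Sum>m\<in>squarefree_upto y. w m * (\<Sum>p\<in>?B m. v p * \<phi> p))"
    using finB by (subst sum.Sigma[symmetric]) (simp_all add: sum_distrib_left)
  finally show ?thesis .
qed

subsection \<open>Mertens' first theorem\<close>

text \<open>The two middle entries of row \<open>2 * m + 1\<close> of Pascal's triangle are equal,
  and together they are at most the row sum 2 * 4^m.\<close>

lemma binomial_odd_le: "(2 * m + 1) choose m \<le> 4 ^ m"
proof -
  have "2 * ((2 * m + 1) choose m) = ((2 * m + 1) choose m) + ((2 * m + 1) choose (m + 1))"
    using binomial_symmetric[of m "2 * m + 1"] by simp
  also have "\<dots> = (\<Sum>k\<in>{m, m + 1}. (2 * m + 1) choose k)" by simp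
  also have "\<dots> \<le> (\<Sum>k\<le>2 * m + 1. (2 * m + 1) choose k)"
    by (intro sum_mono2) auto
  also have "\<dots> = 2 ^ (2 * m + 1)" by (rule choose_row_sum)
  also have "\<dots> = 2 * 4 ^ m" by (simp add: power_mult)
  finally show ?thesis by simp
qed

lemma prod_primes_dvd:
  assumes "finite S" "\<And>p. p \<in> S \<Longrightarrow> prime p \<and> p dvd (n :: nat)"
  shows "\<Prod>S dvd n"
  using assms
proof (induction S)
  case (insert p S)
  have "coprime p (\<Prod>S)"
    using insert by (intro prod_coprime_right) (metis insertCI primes_coprime)
  then show ?case using insert by (simp add: divides_mult)
qed simp

text \<open>Strong induction in Erdos' style: an even n > 2 is not prime, and for n = 2 m + 1 the
  primes above m + 1 are controlled by one binomial coefficient while the induction hypothesis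
  handles the rest.\<close>

lemma prod_primes_le: "\<Prod>{p :: nat. prime p \<and> p \<le> n} \<le> 4 ^ n"
proof (induction n rule: less_induct)
  case (less n)
  let ?P = "\<lambda>n. {p :: nat. prime p \<and> p \<le> n}"
  consider "n \<le> 1" | "n = 2" | "n > 2" "even n" | m where "n = 2 * m + 1" "m > 0"
  proof -
    consider "n \<le> 1" | "n = 2" | "n > 2" "even n" | "n > 2" "odd n" by linarith
    then show thesis
    proof cases
      case 4
      then show ?thesis using that(4)[of "n div 2"] by auto
    qed (use that in auto)
  qed
  then show ?case
  proof cases
    case 1
    then have "\<not> (prime p \<and> p \<le> n)" for p using prime_ge_2_nat[of p] by auto
    then have "?P n = {}" by blast
    then show ?thesis by (simp only: prod.empty) simp
  next
    case 2
    then have "?P n = {2}" by (auto intro: antisym dest: prime_ge_2_nat)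
    then show ?thesis using 2 by (simp only: prod.insert) simp
  next
    case 3
    have "\<not> prime n" using 3 by (metis primes_dvd_imp_eq two_is_prime_nat order_less_irrefl)
    then have "p \<le> n \<longleftrightarrow> p \<le> n - 1" if "prime p" for p
      using that by (cases "p = n") auto
    then have "?P n = ?P (n - 1)" by blast
    then have "\<Prod>(?P n) \<le> 4 ^ (n - 1)" using less[of "n - 1"] 3 by simp
    also have "\<dots> \<le> 4 ^ n" by (intro power_increasing) auto
    finally show ?thesis .
  next
    case 4
    let ?Q = "{p :: nat. prime p \<and> m + 1 < p \<and> p \<le> n}"
    have split: "?P n = ?P (m + 1) \<union> ?Q" using 4 by auto
    \<comment> \<open>A prime in (m + 1, 2 m + 1] divides n! but neither m! nor (n - m)! = (m + 1)!,
      so it survives in the binomial coefficient.\<close>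
    have "\<Prod>?Q dvd (n choose m)"
    proof (rule prod_primes_dvd)
      fix p assume p: "p \<in> ?Q"
      have "p dvd fact n" using p prime_dvd_fact_iff[of p n] by auto
      then have "p dvd fact m * fact (n - m) * (n choose m)"
        using binomial_fact_lemma[of m n] 4 by simp
      moreover have "\<not> p dvd fact m" "\<not> p dvd fact (n - m)"
        using p 4 by (auto simp: prime_dvd_fact_iff simp del: fact_Suc)
      ultimately show "prime p \<and> p dvd (n choose m)" using p by (auto simp: prime_dvd_mult_iff)
    qed simp
    then have "\<Prod>?Q \<le> (n choose m)" using 4 by (intro dvd_imp_le) (auto simp: zero_less_binomial_iff)
    also have "\<dots> \<le> 4 ^ m" using binomial_odd_le[of m] 4 by simp
    finally have Q: "\<Prod>?Q \<le> 4 ^ m" .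
    have "\<Prod>(?P n) = \<Prod>(?P (m + 1)) * \<Prod>?Q" unfolding split
      by (intro prod.union_disjoint) auto
    also have "\<dots> \<le> 4 ^ (m + 1) * 4 ^ m"
      using less[of "m + 1"] 4 Q by (intro mult_mono) auto
    also have "\<dots> = 4 ^ n" using 4 by (simp add: power_add mult_2)
    finally show ?thesis .
  qed
qed

text \<open>This pays for rounding n/p down to an integer for every prime in the upper Mertens
  estimate.\<close>

lemma sum_ln_primes_le: "(\<Sum>p | prime p \<and> p \<le> n. ln (real p)) \<le> real n * ln 4"
proof -
  have "(\<Sum>p | prime p \<and> p \<le> n. ln (real p)) = ln (\<Prod>p | prime p \<and> p \<le> n. real p)"
    by (intro ln_prod[symmetric]) (auto dest: prime_gt_0_nat)
  also have "\<dots> = ln (real (\<Prod>{p. prime p \<and> p \<le> n}))" by simp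
  also have "\<dots> \<le> ln (real (4 ^ n))"
    using prod_primes_le[of n]
    by (intro ln_mono) (auto simp only: of_nat_le_iff of_nat_0_less_iff intro!: prod_pos dest: prime_gt_0_nat)
  also have "\<dots> = real n * ln 4" by (simp add: ln_realpow)
  finally show ?thesis .
qed

section \<open>Prime multiplicities in n! and the size of ln n!\<close>

lemma card_multiples_upto:
  assumes "q > (0 :: nat)"
  shows "card {m \<in> {1..n}. q dvd m} = n div q"
proof -
  have "bij_betw (\<lambda>k. q * k) {1..n div q} {m \<in> {1..n}. q dvd m}"
    by (rule bij_betwI[where g = "\<lambda>m. m div q"])
       (use assms in \<open>auto simp: less_eq_div_iff_mult_less_eq mult.commute dvd_imp_le div_greater_zero_iff div_le_mono intro!: Suc_leI\<close>)
  from bij_betw_same_card[OF this] show ?thesis by simp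
qed

lemma multiplicity_fact:
  assumes p: "prime (p :: nat)"
  shows "multiplicity p (fact n :: nat) = (\<Sum>m=1..n. multiplicity p m)"
proof (induction n)
  case (Suc n)
  have "multiplicity p (fact (Suc n) :: nat) = multiplicity p (Suc n) + multiplicity p (fact n :: nat)"
    unfolding fact_Suc using p by (simp add: prime_elem_multiplicity_mult_distrib del: mult_Suc)
  with Suc show ?case by simp
qed simp

text \<open>Only the first term of Legendre's sum of n div p^j is kept.\<close>

lemma multiplicity_fact_ge:
  assumes p: "prime (p :: nat)"
  shows "n div p \<le> multiplicity p (fact n :: nat)"
proof -
  have "n div p = card {m \<in> {1..n}. p dvd m}"
    using card_multiples_upto[of p n] prime_gt_0_nat[OF p] by simp
  also have "\<dots> = (\<Sum>m=1..n. of_bool (p dvd m))" by (simp add: Int_def)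
  also have "\<dots> \<le> (\<Sum>m=1..n. multiplicity p m)"
    using p by (intro sum_mono) (auto simp: Suc_le_eq prime_multiplicity_gt_zero_iff)
  finally show ?thesis by (simp only: multiplicity_fact[OF p])
qed

text \<open>All terms of Legendre's sum are kept, each is bounded by n/p^j, and the geometric series
  gives the denominator p - 1.\<close>

lemma multiplicity_fact_le:
  assumes p: "prime (p :: nat)"
  shows "real (multiplicity p (fact n :: nat)) \<le> real n / (real p - 1)"
proof -
  have p2: "real p \<ge> 2" using prime_ge_2_nat[OF p] by simp
  note multiplicity_fact[OF p, of n]
  also have "(\<Sum>m=1..n. multiplicity p m) \<le> (\<Sum>m=1..n. \<Sum>j=1..n. of_bool (p ^ j dvd m))"
  proof (rule sum_mono)
    fix m assume m: "m \<in> {1..n}"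
    let ?v = "multiplicity p m"
    \<comment> \<open>Since v < p^v <= m <= n, every exponent counted by the multiplicity lies in
      {1..n}, so letting \<open>j\<close> run up to \<open>n\<close> loses nothing.\<close>
    have "p ^ ?v \<le> m" using m by (intro dvd_imp_le multiplicity_dvd) auto
    moreover have "?v < p ^ ?v" using prime_gt_1_nat[OF p] by (simp add: power_gt_expt)
    ultimately have "{1..?v} \<subseteq> {j \<in> {1..n}. p ^ j dvd m}"
      using m by (auto intro: multiplicity_dvd')
    then have "card {1..?v} \<le> card {j \<in> {1..n}. p ^ j dvd m}" by (intro card_mono) auto
    also have "\<dots> = (\<Sum>j=1..n. of_bool (p ^ j dvd m))" by (simp add: Int_def)
    finally show "?v \<le> (\<Sum>j=1..n. of_bool (p ^ j dvd m))" by simp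
  qed
  also have "\<dots> = (\<Sum>j=1..n. \<Sum>m=1..n. of_bool (p ^ j dvd m))" by (rule sum.swap)
  also have "\<dots> = (\<Sum>j=1..n. card {m \<in> {1..n}. p ^ j dvd m})" by (simp add: Int_def)
  also have "\<dots> = (\<Sum>j=1..n. n div p ^ j)"
    using prime_gt_0_nat[OF p] by (intro sum.cong refl card_multiples_upto) auto
  finally have "real (multiplicity p (fact n :: nat)) \<le> (\<Sum>j=1..n. real (n div p ^ j))"
    by (metis of_nat_le_iff of_nat_sum)
  also have "\<dots> \<le> (\<Sum>j=1..n. real n * (1 / real p) ^ j)"
    using of_nat_div_le_of_nat[of n "p ^ j" for j] by (intro sum_mono) (simp add: power_divide)
  also have "\<dots> = real n * (\<Sum>j=1..n. (1 / real p) ^ j)" by (simp add: sum_distrib_left)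
  also have "(\<Sum>j=1..n. (1 / real p) ^ j) \<le> 1 / (real p - 1)"
  proof -
    define q where "q = 1 / real p"
    have "(\<Sum>j=1..n. q ^ j) * (1 - q) = q - q ^ Suc n"
    proof (induction n)
      case (Suc n)
      then show ?case by (simp add: distrib_right) (simp add: algebra_simps)
    qed simp
    also have "\<dots> \<le> q" using p2 by (simp add: q_def)
    finally have "(\<Sum>j=1..n. q ^ j) \<le> q / (1 - q)" using p2 by (subst pos_le_divide_eq) (auto simp: q_def)
    also have "\<dots> = 1 / (real p - 1)" using p2 by (simp add: q_def field_simps)
    finally show ?thesis by (simp add: q_def)
  qed
  finally show ?thesis using p2 by (simp add: mult_left_mono)
qed

lemma ln_fact_eq:
  "ln (fact n) = (\<Sum>p | prime p \<and> p \<le> n. real (multiplicity p (fact n :: nat)) * ln (real p))"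
proof -
  have pf: "prime_factors (fact n :: nat) = {p. prime p \<and> p \<le> n}"
    by (auto simp: prime_factors_dvd prime_dvd_fact_iff)
  have "(fact n :: nat) = (\<Prod>p | prime p \<and> p \<le> n. p ^ multiplicity p (fact n :: nat))"
    using prime_factorization_nat[of "fact n"] by (simp add: pf)
  from arg_cong[OF this, of real]
  have "ln (fact n) = ln (\<Prod>p | prime p \<and> p \<le> n. real p ^ multiplicity p (fact n :: nat))"
    by (simp add: of_nat_prod)
  also have "\<dots> = (\<Sum>p | prime p \<and> p \<le> n. ln (real p ^ multiplicity p (fact n :: nat)))"
    by (intro ln_prod) (auto dest: prime_gt_0_nat)
  also have "\<dots> = (\<Sum>p | prime p \<and> p \<le> n. real (multiplicity p (fact n :: nat)) * ln (real p))"
    by (intro sum.cong refl ln_realpow)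
  finally show ?thesis .
qed

text \<open>The induction step amounts to n (ln (n + 1) - ln n) <= 1, which is ln (1 + 1/n) <=
  1/n.\<close>

lemma ln_fact_ge:
  assumes "n > 0"
  shows "real n * ln (real n) - real n \<le> ln (fact n)"
  using assms
proof (induction n rule: nat_induct_non_zero)
  case (Suc n)
  have "ln (real (Suc n)) - ln (real n) = ln (1 + 1 / real n)"
    using Suc ln_div[of "real (Suc n)" "real n"] by (simp add: add_divide_distrib add.commute)
  also have "\<dots> \<le> 1 / real n" by (intro ln_add_one_self_le_self) auto
  finally have "real n * (ln (real (Suc n)) - ln (real n)) \<le> 1"
    using Suc by (simp add: field_simps)
  moreover have "ln (fact (Suc n)) = ln (real (Suc n)) + ln (fact n)"
    by (simp add: ln_mult del: of_nat_Suc)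
  ultimately show ?case using Suc.IH by (simp add: algebra_simps)
qed simp

lemma ln_fact_le: "ln (fact n) \<le> real n * ln (real n)"
proof (cases "n = 0")
  case False
  have "ln (fact n) \<le> ln (real n ^ n)"
    using fact_le_power[of n, where 'a = real] False by (intro ln_mono) auto
  also have "\<dots> = real n * ln (real n)" using False by (simp add: ln_realpow)
  finally show ?thesis .
qed simp

section \<open>Sums of ln p / p\<close>

text \<open>Comparing with ln n! <= n ln n: each prime contributes at least (n div p) ln p to ln n!,
  and replacing n div p by n/p costs at most the sum of ln p, which is at most n ln 4.\<close>

lemma mertens_upper:
  assumes "n > 0"
  shows "(\<Sum>p | prime p \<and> p \<le> n. ln (real p) / real p) \<le> ln (real n) + ln 4"
proof -
  let ?P = "{p. prime p \<and> p \<le> n}"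
  have "real n * (\<Sum>p\<in>?P. ln (real p) / real p) = (\<Sum>p\<in>?P. real n / real p * ln (real p))"
    by (simp add: sum_distrib_left field_simps)
  also have "\<dots> \<le> (\<Sum>p\<in>?P. (real (multiplicity p (fact n :: nat)) + 1) * ln (real p))"
  proof (intro sum_mono mult_right_mono)
    fix p assume p: "p \<in> ?P"
    then have pp: "prime p" by simp
    have "real n / real p \<le> real (n div p) + 1"
      using floor_divide_of_nat_eq[of n p, where 'a = real] by linarith
    also have "\<dots> \<le> real (multiplicity p (fact n :: nat)) + 1"
      using multiplicity_fact_ge[OF pp, of n] by linarith
    finally show "real n / real p \<le> real (multiplicity p (fact n :: nat)) + 1" .
    show "ln (real p) \<ge> 0" using prime_ge_1_nat[OF pp] by simp
  qed
  also have "\<dots> = ln (fact n) + (\<Sum>p\<in>?P. ln (real p))"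
    by (simp add: ln_fact_eq distrib_right sum.distrib)
  also have "\<dots> \<le> real n * ln (real n) + real n * ln 4"
    using ln_fact_le[of n] sum_ln_primes_le[of n] by linarith
  also have "\<dots> = real n * (ln (real n) + ln 4)" by (simp add: algebra_simps)
  finally show ?thesis using assms by simp
qed

lemma mertens_lower:
  assumes "n > 0"
  shows "ln (real n) - 1 \<le> (\<Sum>p | prime p \<and> p \<le> n. ln (real p) / (real p - 1))"
proof -
  let ?P = "{p. prime p \<and> p \<le> n}"
  have "real n * (ln (real n) - 1) \<le> ln (fact n)"
    using ln_fact_ge[OF assms] by (simp add: algebra_simps)
  also have "\<dots> \<le> (\<Sum>p\<in>?P. real n / (real p - 1) * ln (real p))"
    unfolding ln_fact_eq
    by (intro sum_mono mult_right_mono multiplicity_fact_le) (auto dest: prime_ge_1_nat)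
  also have "\<dots> = real n * (\<Sum>p\<in>?P. ln (real p) / (real p - 1))"
    by (simp add: sum_distrib_left)
  finally show ?thesis using assms by simp
qed

lemma ln_le_2_sqrt: 
  assumes "x > 0" shows "ln x \<le> 2 * sqrt x"
proof -
  have "ln x = 2 * ln (sqrt x)" using assms by (simp add: ln_sqrt)
  also have "\<dots> \<le> 2 * sqrt x" using ln_le_minus_one[of "sqrt x"] assms by simp
  finally show ?thesis .
qed

text \<open>The bound ln n <= 2 sqrt n gives the convergent majorant 2 n^(-3/2). It is uniform in
  the finite set because the sets of primes it is applied to vary with \<open>y\<close> and
  \<open>m\<close>.\<close>

lemma sum_ln_over_square_bounded:
  "\<exists>B\<ge>0. \<forall>S. finite S \<longrightarrow> (\<Sum>n\<in>S. ln (real n) / (real n)\<^sup>2) \<le> B"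
proof -
  let ?f = "\<lambda>n. 2 * real n powr (-3/2)"
  have sm: "summable ?f" by (intro summable_mult) (simp add: summable_real_powr_iff)
  have le: "ln (real n) / (real n)\<^sup>2 \<le> ?f n" for n
  proof (cases "n = 0")
    case False
    have "ln (real n) / (real n)\<^sup>2 \<le> 2 * real n powr (1/2) / real n powr 2"
      using ln_le_2_sqrt[of "real n"] False
      by (simp add: powr_half_sqrt divide_right_mono powr_numeral)
    also have "\<dots> = 2 * real n powr (1/2 - 2)" by (simp only: powr_diff times_divide_eq_right)
    also have "\<dots> = ?f n" by simp
    finally show ?thesis .
  qed simp
  have "(\<Sum>n\<in>S. ln (real n) / (real n)\<^sup>2) \<le> suminf ?f" if "finite S" for S
  proof -
    have "(\<Sum>n\<in>S. ln (real n) / (real n)\<^sup>2) \<le> (\<Sum>n\<in>S. ?f n)" by (intro sum_mono le)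
    also have "\<dots> \<le> suminf ?f" using that sm by (intro sum_le_suminf) auto
    finally show ?thesis .
  qed
  moreover have "suminf ?f \<ge> 0" by (intro suminf_nonneg sm) auto
  ultimately show ?thesis by blast
qed

text \<open>The denominator p + 1 is the one in the weights. It lies on the right side of
  \<open>p\<close> for the upper bound; for the lower bound the passage from p - 1 to p + 1 costs a
  convergent sum.\<close>

lemma mertens_first:
  "\<exists>A\<ge>0. \<forall>y\<ge>1. \<bar>(\<Sum>p | prime p \<and> real p \<le> y. ln (real p) / (real p + 1)) - ln y\<bar> \<le> A"
proof -
  obtain B where B: "B \<ge> 0" "\<And>S. finite S \<Longrightarrow> (\<Sum>n\<in>S. ln (real n) / (real n)\<^sup>2) \<le> B"
    using sum_ln_over_square_bounded by blast
  have "\<bar>(\<Sum>p | prime p \<and> real p \<le> y. ln (real p) / (real p + 1)) - ln y\<bar> \<le> 4 * B + 4"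
    if y: "y \<ge> 1" for y
  proof -
    define n where "n = nat \<lfloor>y\<rfloor>"
    have n: "n > 0" "real n \<le> y" "y \<le> 2 * real n"
    proof -
      have "\<lfloor>y\<rfloor> \<ge> 1" using y by simp
      then have "real n = real_of_int \<lfloor>y\<rfloor>" "n > 0" by (auto simp: n_def)
      then have "real n \<le> y" "y < real n + 1" "real n \<ge> 1" by linarith+
      then show "n > 0" "real n \<le> y" "y \<le> 2 * real n" by linarith+
    qed
    let ?P = "{p. prime p \<and> p \<le> n}"
    have P: "{p. prime p \<and> real p \<le> y} = ?P"
      using y by (auto simp: n_def le_nat_floor le_nat_iff le_floor_iff)
    have p2: "real p \<ge> 2" if "p \<in> ?P" for p
      using that prime_ge_2_nat[of p] by simp
    have "(\<Sum>p\<in>?P. ln (real p) / (real p + 1)) \<le> (\<Sum>p\<in>?P. ln (real p) / real p)"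
    proof (rule sum_mono)
      fix p assume "p \<in> ?P"
      from p2[OF this] show "ln (real p) / (real p + 1) \<le> ln (real p) / real p"
        by (intro divide_left_mono) auto
    qed
    also have "\<dots> \<le> ln y + ln 4"
    proof -
      have "ln (real n) \<le> ln y" using n by (intro ln_mono) auto
      then show ?thesis using mertens_upper[OF n(1)] by linarith
    qed
    finally have up: "(\<Sum>p\<in>?P. ln (real p) / (real p + 1)) \<le> ln y + ln 4" .
    have "ln (real n) - 1 \<le> (\<Sum>p\<in>?P. ln (real p) / (real p - 1))"
      by (rule mertens_lower[OF n(1)])
    also have "\<dots> \<le> (\<Sum>p\<in>?P. ln (real p) / (real p + 1) + 4 * (ln (real p) / (real p)\<^sup>2))"
    proof (rule sum_mono)
      fix p assume p: "p \<in> ?P"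
      define x where "x = real p"
      have x: "x \<ge> 2" using p2[OF p] by (simp add: x_def)
      have "2 * 2 \<le> x * x" using x by (intro mult_mono) auto
      then have xx: "x * x \<noteq> 1" "x\<^sup>2 \<ge> 4" by (auto simp: power2_eq_square)
      \<comment> \<open>The difference 2/(x^2 - 1) is at most 4/x^2 because x^2 - 1 >= x^2/2; this
        is the source of \<open>4 * B\<close>.\<close>
      have "1 / (x - 1) = 1 / (x + 1) + 2 / (x\<^sup>2 - 1)"
        using x xx by (simp add: divide_simps power2_eq_square) (simp add: algebra_simps)
      also have "2 / (x\<^sup>2 - 1) \<le> 2 / (x\<^sup>2 / 2)"
      proof (intro divide_left_mono)
        show "x\<^sup>2 / 2 \<le> x\<^sup>2 - 1" "0 < (x\<^sup>2 - 1) * (x\<^sup>2 / 2)"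
          using x xx by (simp_all add: zero_less_mult_iff)
      qed simp
      finally have "ln x * (1 / (x - 1)) \<le> ln x * (1 / (x + 1) + 4 / x\<^sup>2)"
        using x by (intro mult_left_mono) auto
      then show "ln (real p) / (real p - 1) \<le> ln (real p) / (real p + 1) + 4 * (ln (real p) / (real p)\<^sup>2)"
        by (simp add: x_def algebra_simps)
    qed
    also have "\<dots> = (\<Sum>p\<in>?P. ln (real p) / (real p + 1)) + 4 * (\<Sum>p\<in>?P. ln (real p) / (real p)\<^sup>2)"
      by (simp add: sum.distrib sum_distrib_left)
    also have "\<dots> \<le> (\<Sum>p\<in>?P. ln (real p) / (real p + 1)) + 4 * B"
      using B(2)[of ?P] by simp
    finally have lo: "ln (real n) - 1 \<le> (\<Sum>p\<in>?P. ln (real p) / (real p + 1)) + 4 * B" .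
    have "ln y \<le> ln (2 * real n)" using n y by (intro ln_mono) auto
    also have "\<dots> = ln 2 + ln (real n)" using n by (simp add: ln_mult)
    finally have "ln y \<le> ln 2 + ln (real n)" .
    \<comment> \<open>Rounding \<open>y\<close> down to \<open>n\<close> costs ln 2, as y <= 2 n. So
      the lower bound misses ln y by at most 4 B + 2 and the upper one by at most ln 4 <= 3;
      \<open>4 * B + 4\<close> covers both.\<close>
    moreover have "ln 2 \<le> (1 :: real)" "ln 4 \<le> (3 :: real)" using ln_le_minus_one[of 2] ln_le_minus_one[of 4] by auto
    ultimately show ?thesis using up lo B(1) unfolding P by linarith
  qed
  then show ?thesis using B(1) by (intro exI[of _ "4 * B + 4"]) auto
qed

subsection \<open>Counting squarefree numbers\<close>

lemma moebius_mu_prime_mult: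
  assumes "prime q" "squarefree e" "\<not> q dvd e"
  shows "moebius_mu (q * e) = - moebius_mu e"
proof -
  have "e > 0" using assms by (intro Nat.gr0I) auto
  then have "q \<notin> prime_factors e" "prime_factors (q * e) = insert q (prime_factors e)"
    using assms by (auto simp: prime_factors_prime_mult)
  then show ?thesis using assms by (simp add: moebius_mu_def squarefree_prime_mult_iff)
qed

lemma abs_moebius_mu_le: "\<bar>moebius_mu n\<bar> \<le> 1"
  by (simp add: moebius_mu_def)

text \<open>For a prime q dividing n, the squarefree divisors pair off as e and q e with q not
  dividing e, and the two signs cancel.\<close>

lemma sum_moebius_mu_divisors:
  assumes "n > 0"
  shows "(\<Sum>d | d dvd n. moebius_mu d) = of_bool (n = 1)"
proof (cases "n = 1")
  case True
  then show ?thesis by (simp add: moebius_mu_def)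
next
  case False
  then obtain q where q: "prime q" "q dvd n" using prime_factor_nat by blast
  have fin: "finite {d. d dvd n}" using assms by simp
  let ?A = "{d. d dvd n \<and> squarefree d \<and> \<not> q dvd d}"
  let ?B = "{d. d dvd n \<and> squarefree d \<and> q dvd d}"
  have "bij_betw (\<lambda>e. q * e) ?A ?B"
  proof (rule bij_betwI[where g = "\<lambda>d. d div q"])
    show "(\<lambda>e. q * e) \<in> ?A \<rightarrow> ?B"
      using q by (auto simp: squarefree_prime_mult_iff intro!: divides_mult prime_imp_coprime)
    show "(\<lambda>d. d div q) \<in> ?B \<rightarrow> ?A"
    proof
      fix d assume "d \<in> ?B"
      then obtain e where "d = q * e" "d dvd n" "squarefree d" by (auto elim: dvdE)
      then show "d div q \<in> ?A" using q
        by (auto simp: squarefree_prime_mult_iff intro: dvd_trans dvd_triv_right)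
    qed
  qed (use q in auto)
  from sum.reindex_bij_betw[OF this, of moebius_mu]
  have "(\<Sum>d\<in>?B. moebius_mu d) = (\<Sum>e\<in>?A. moebius_mu (q * e))" by simp
  also have "\<dots> = - (\<Sum>e\<in>?A. moebius_mu e)"
    using q by (simp add: moebius_mu_prime_mult sum_negf[symmetric])
  finally have "(\<Sum>d\<in>?A. moebius_mu d) + (\<Sum>d\<in>?B. moebius_mu d) = 0" by simp
  also have "(\<Sum>d\<in>?A. moebius_mu d) + (\<Sum>d\<in>?B. moebius_mu d) = (\<Sum>d\<in>?A \<union> ?B. moebius_mu d)"
    by (intro sum.union_disjoint[symmetric] finite_subset[OF _ fin]) auto
  also have "\<dots> = (\<Sum>d | d dvd n. moebius_mu d)"
    using fin by (intro sum.mono_neutral_left) (auto simp: moebius_mu_def)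
  finally show ?thesis using False by simp
qed

text \<open>The \<open>e\<close> with e^2 dividing m are the divisors of
  \<open>square_part m\<close>, which equals 1 exactly for squarefree m; so the previous divisor sum
  applies.\<close>

lemma sum_moebius_mu_square_divisors:
  assumes "m > 0"
  shows "(\<Sum>e | e\<^sup>2 dvd m. moebius_mu e) = of_bool (squarefree m)"
proof -
  have "square_part m = 1 \<longleftrightarrow> squarefree m"
    using square_part_square_dvd[of m]
    by (metis dvd_square_part_iff nat_dvd_1_iff_1 squarefreeD squarefreeI)
  moreover have "square_part m > 0" using assms by (intro Nat.gr0I) simp
  ultimately show ?thesis
    using sum_moebius_mu_divisors[of "square_part m"]
    by (simp add: dvd_square_part_iff[symmetric])
qed

lemma nat_floor_div_bounds:
  assumes "y \<ge> 0" "q > 0"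
  shows "\<bar>real (nat \<lfloor>y\<rfloor> div q) - y / real q\<bar> \<le> 1"
proof -
  have "int (nat \<lfloor>y\<rfloor> div q) = \<lfloor>y\<rfloor> div int q" using assms by (simp add: zdiv_int)
  from arg_cong[OF this, of real_of_int]
  have "real (nat \<lfloor>y\<rfloor> div q) = real_of_int (\<lfloor>y\<rfloor> div int q)" by simp
  also have "\<dots> = real_of_int \<lfloor>y / real q\<rfloor>"
    using floor_divide_real_eq_div[of "int q" y] by simp
  finally show ?thesis by linarith
qed

lemma sum_inverse_squares_le:
  assumes "n > 0" "n \<le> N"
  shows "(\<Sum>e\<in>{n<..N}. 1 / (real e)\<^sup>2) \<le> 1 / real n"
proof -
  \<comment> \<open>The strengthening by 1/N makes the induction step the telescoping estimate
    1/(N+1)^2 <= 1/N - 1/(N+1).\<close>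
  have "(\<Sum>e\<in>{n<..N}. 1 / (real e)\<^sup>2) \<le> 1 / real n - 1 / real N"
    using assms(2)
  proof (induction N rule: dec_induct)
    case (step N)
    have N: "real N > 0" using step assms by simp
    have "{n<..Suc N} = insert (Suc N) {n<..N}" using step by auto
    then have "(\<Sum>e\<in>{n<..Suc N}. 1 / (real e)\<^sup>2) \<le> 1 / (real N + 1)\<^sup>2 + (1 / real n - 1 / real N)"
      using step by (simp add: add.commute)
    also have "1 / (real N + 1)\<^sup>2 \<le> 1 / real N - 1 / (real N + 1)"
      using N by (simp add: divide_simps power2_eq_square)
    finally show ?case by (simp add: add.commute)
  qed simp
  moreover have "1 / real N \<ge> 0" by simp
  ultimately show ?thesis by linarith
qed

text \<open>The number \<open>a\<close> is 1/zeta(2). Instead of evaluating it, the bounds on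
  \<open>a\<close> are read off from the partial sum 1 - 1/4 and the tail estimate 1/2 at n =
  2.\<close>

lemma moebius_mu_square_series:
  obtains a where "1/4 \<le> a" "a \<le> 3"
    "\<And>n. n > 0 \<Longrightarrow> \<bar>(\<Sum>e=1..n. moebius_mu e / (real e)\<^sup>2) - a\<bar> \<le> 1 / real n"
proof -
  let ?f = "\<lambda>e. moebius_mu e / (real e)\<^sup>2"
  let ?s = "\<lambda>n. \<Sum>e=1..n. ?f e"
  have "summable ?f"
  proof (rule summable_comparison_test')
    show "summable (\<lambda>e. inverse (real e ^ 2))" by (rule inverse_power_summable) simp
    show "norm (?f e) \<le> inverse (real e ^ 2)" for e
      using abs_moebius_mu_le[of e] by (simp add: abs_mult divide_inverse mult_left_le_one_le)
  qed
  then obtain a where a: "?f sums a" by (auto simp: summable_def)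
  have "(\<lambda>n. \<Sum>e<Suc n. ?f e) \<longlonglongrightarrow> a" using a unfolding sums_def by (rule LIMSEQ_Suc)
  moreover have "(\<Sum>e<Suc n. ?f e) = ?s n" for n
    by (intro sum.mono_neutral_right) (auto simp: moebius_mu_def)
  ultimately have lim: "?s \<longlonglongrightarrow> a" by simp
  have tail: "\<bar>?s n - a\<bar> \<le> 1 / real n" if "n > 0" for n
  proof -
    have "\<bar>?s n - ?s N\<bar> \<le> 1 / real n" if N: "N \<ge> n" for N
    proof -
      have "{1..N} = {1..n} \<union> {n<..N}" using N \<open>n > 0\<close> by auto
      then have "?s N = ?s n + (\<Sum>e\<in>{n<..N}. ?f e)"
        by (simp add: sum.union_disjoint Int_def)
      then have "\<bar>?s n - ?s N\<bar> = \<bar>\<Sum>e\<in>{n<..N}. ?f e\<bar>" by simp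
      also have "\<dots> \<le> (\<Sum>e\<in>{n<..N}. \<bar>?f e\<bar>)" by (rule sum_abs)
      also have "\<dots> \<le> (\<Sum>e\<in>{n<..N}. 1 / (real e)\<^sup>2)"
        using abs_moebius_mu_le by (intro sum_mono) (simp add: abs_divide divide_right_mono)
      also have "\<dots> \<le> 1 / real n" using N \<open>n > 0\<close> by (intro sum_inverse_squares_le) auto
      finally show ?thesis .
    qed
    moreover have "(\<lambda>N. \<bar>?s n - ?s N\<bar>) \<longlonglongrightarrow> \<bar>?s n - a\<bar>" by (intro tendsto_intros lim)
    ultimately show ?thesis by (intro LIMSEQ_le_const2) auto
  qed
  have "moebius_mu 2 = -1" using moebius_mu_prime_mult[of 2 1] by (simp add: moebius_mu_def)
  moreover have "{1..2 :: nat} = {1, 2}" by auto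
  ultimately have s2: "?s 2 = 3/4" by (simp add: moebius_mu_def)
  have "\<bar>3/4 - a\<bar> \<le> 1/2" using tail[of 2] unfolding s2 by simp
  then have "1/4 \<le> a" "a \<le> 3" by linarith+
  with tail show ?thesis using that by blast
qed

text \<open>The indicator of squarefree m is expanded over e^2 dividing m and the sums are
  exchanged; e^2 <= m <= y confines \<open>e\<close> to at most sqrt y values.\<close>

lemma card_squarefree_upto:
  assumes "y \<ge> 0"
  shows "real (card (squarefree_upto y)) =
    (\<Sum>e=1..nat \<lfloor>sqrt y\<rfloor>. moebius_mu e * real (nat \<lfloor>y\<rfloor> div e\<^sup>2))"
proof -
  let ?n = "nat \<lfloor>sqrt y\<rfloor>" and ?N = "nat \<lfloor>y\<rfloor>"
  have iff: "m \<le> ?N \<longleftrightarrow> real m \<le> y" for m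
    using assms by (simp add: le_nat_iff le_floor_iff)
  have "squarefree_upto y = {m \<in> {1..?N}. squarefree m}"
    using iff by (auto simp: squarefree_upto_def Suc_le_eq intro: Nat.gr0I)
  then have "real (card (squarefree_upto y)) = (\<Sum>m=1..?N. of_bool (squarefree m))"
    by (simp add: Int_def)
  also have "\<dots> = (\<Sum>m=1..?N. \<Sum>e=1..?n. moebius_mu e * of_bool (e\<^sup>2 dvd m))"
  proof (intro sum.cong refl)
    fix m assume m: "m \<in> {1..?N}"
    have sub: "{e. e\<^sup>2 dvd m} \<subseteq> {1..?n}"
    proof
      fix e assume e: "e \<in> {e. e\<^sup>2 dvd m}"
      then have "e\<^sup>2 \<le> m" using m by (intro dvd_imp_le) auto
      then have "real (e\<^sup>2) \<le> y" using m iff[of m] by (meson atLeastAtMost_iff of_nat_mono order_trans)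
      then have "real e \<le> sqrt y" by (intro real_le_rsqrt) simp
      moreover have "e > 0" using e m by (intro Nat.gr0I) auto
      ultimately show "e \<in> {1..?n}" using assms by (auto simp: le_nat_iff le_floor_iff)
    qed
    have "of_bool (squarefree m) = (\<Sum>e | e\<^sup>2 dvd m. moebius_mu e)"
      using sum_moebius_mu_square_divisors[of m] m by simp
    also have "\<dots> = (\<Sum>e=1..?n. moebius_mu e * of_bool (e\<^sup>2 dvd m))"
      using sub by (intro sum.mono_neutral_cong_left) auto
    finally show "of_bool (squarefree m) = (\<Sum>e=1..?n. moebius_mu e * of_bool (e\<^sup>2 dvd m))" .
  qed
  also have "\<dots> = (\<Sum>e=1..?n. \<Sum>m=1..?N. moebius_mu e * of_bool (e\<^sup>2 dvd m))" by (rule sum.swap)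
  also have "\<dots> = (\<Sum>e=1..?n. moebius_mu e * real (card {m \<in> {1..?N}. e\<^sup>2 dvd m}))"
    by (simp add: sum_distrib_left[symmetric] Int_def)
  also have "\<dots> = (\<Sum>e=1..?n. moebius_mu e * real (?N div e\<^sup>2))"
    by (intro sum.cong refl arg_cong2[where f = "(*)"] arg_cong[where f = real] card_multiples_upto) auto
  finally show ?thesis .
qed

text \<open>Of the error 3 sqrt y, one part sqrt y comes from at most sqrt y rounding errors of size
  1, and 2 sqrt y from the tail of the series cut at n >= sqrt y / 2, multiplied by y.\<close>

lemma squarefree_density:
  obtains a where "a > 0" "a \<le> 3"
    "\<And>y. y \<ge> 0 \<Longrightarrow> \<bar>real (card (squarefree_upto y)) - a * y\<bar> \<le> 3 * sqrt y"
proof -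
  obtain a where a: "1/4 \<le> a" "a \<le> 3"
    "\<And>n. n > 0 \<Longrightarrow> \<bar>(\<Sum>e=1..n. moebius_mu e / (real e)\<^sup>2) - a\<bar> \<le> 1 / real n"
    using moebius_mu_square_series by blast
  have "\<bar>real (card (squarefree_upto y)) - a * y\<bar> \<le> 3 * sqrt y" if y: "y \<ge> 0" for y
  proof (cases "y < 1")
    \<comment> \<open>Here the cut-off \<open>n\<close> would be 0. There is nothing to count, and a
      y <= 3 sqrt y follows from a <= 3 and y < 1.\<close>
    case True
    then have "squarefree_upto y = {}" using squarefree_uptoD(3,4) by force
    moreover have "y \<le> sqrt y" using True y by (intro real_le_rsqrt) (simp add: power2_eq_square mult_left_le)
    then have "a * y \<le> 3 * sqrt y" using a y by (intro mult_mono) auto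
    ultimately show ?thesis using a y by simp
  next
    case False
    define n where "n = nat \<lfloor>sqrt y\<rfloor>"
    let ?s = "\<Sum>e=1..n. moebius_mu e / (real e)\<^sup>2"
    have n: "n > 0" "real n \<le> sqrt y" "sqrt y \<le> 2 * real n"
    proof -
      have "\<lfloor>sqrt y\<rfloor> \<ge> 1" using False by simp
      then have "real n = real_of_int \<lfloor>sqrt y\<rfloor>" "n > 0" by (auto simp: n_def)
      then have "real n \<le> sqrt y" "sqrt y < real n + 1" "real n \<ge> 1" by linarith+
      then show "n > 0" "real n \<le> sqrt y" "sqrt y \<le> 2 * real n" by linarith+
    qed
    have "real (card (squarefree_upto y)) - y * ?s =
      (\<Sum>e=1..n. moebius_mu e * (real (nat \<lfloor>y\<rfloor> div e\<^sup>2) - y / real (e\<^sup>2)))"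
      unfolding card_squarefree_upto[OF y] n_def
      by (simp add: sum_subtractf sum_distrib_left right_diff_distrib mult_ac)
    also have "\<bar>\<dots>\<bar> \<le> (\<Sum>e=1..n. 1)"
    proof (rule order_trans[OF sum_abs], rule sum_mono)
      fix e assume "e \<in> {1..n}"
      then have "\<bar>real (nat \<lfloor>y\<rfloor> div e\<^sup>2) - y / real (e\<^sup>2)\<bar> \<le> 1"
        using y by (intro nat_floor_div_bounds) auto
      then show "\<bar>moebius_mu e * (real (nat \<lfloor>y\<rfloor> div e\<^sup>2) - y / real (e\<^sup>2))\<bar> \<le> 1"
        using abs_moebius_mu_le[of e] by (simp only: abs_mult mult_le_one abs_ge_zero)
    qed
    finally have 1: "\<bar>real (card (squarefree_upto y)) - y * ?s\<bar> \<le> sqrt y" using n by simp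
    have "\<bar>y * ?s - y * a\<bar> = y * \<bar>?s - a\<bar>" using y by (simp add: abs_mult right_diff_distrib[symmetric])
    also have "\<dots> \<le> y * (1 / real n)" using a(3)[OF n(1)] y by (intro mult_left_mono) auto
    also have "\<dots> \<le> 2 * sqrt y"
    proof -
      have "y = sqrt y * sqrt y" using y by simp
      also have "\<dots> \<le> 2 * real n * sqrt y" using n y by (intro mult_right_mono) auto
      finally show ?thesis using n by (simp add: field_simps)
    qed
    finally show ?thesis using 1 by (simp add: mult.commute)
  qed
  with a show ?thesis using that[of a] by auto
qed

section \<open>Squarefree numbers avoiding given primes\<close>

text \<open>With \<open>P\<close> the prime factors of a squarefree d and y = x/d, these are the
  cofactors m for which d m is squarefree and at most x.\<close>

definition squarefree_avoiding :: "nat set \<Rightarrow> real \<Rightarrow> nat set" where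
  "squarefree_avoiding P y = {m \<in> squarefree_upto y. \<forall>p\<in>P. \<not> p dvd m}"

lemma finite_squarefree_avoiding [simp]: "finite (squarefree_avoiding P y)"
  by (simp add: squarefree_avoiding_def)

lemma card_squarefree_avoiding_insert:
  assumes p: "prime p" and P: "p \<notin> P" "\<And>q. q \<in> P \<Longrightarrow> prime q"
  shows "card (squarefree_avoiding P y) =
    card (squarefree_avoiding (insert p P) y) + card (squarefree_avoiding (insert p P) (y / real p))"
proof -
  let ?A = "squarefree_avoiding (insert p P) (y / real p)"
  have p0: "real p \<ge> 1" using prime_ge_1_nat[OF p] by simp
  have "squarefree_avoiding P y = squarefree_avoiding (insert p P) y \<union> (\<lambda>m. p * m) ` ?A"
  proof (intro equalityI subsetI)
    fix m assume m: "m \<in> squarefree_avoiding P y"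
    show "m \<in> squarefree_avoiding (insert p P) y \<union> (\<lambda>m. p * m) ` ?A"
    proof (cases "p dvd m")
      case True
      then obtain k where k: "m = p * k" by (rule dvdE)
      have "squarefree k \<and> \<not> p dvd k"
        using m squarefree_prime_mult_iff[OF p, of k]
        by (simp add: k squarefree_avoiding_def squarefree_upto_def)
      then have "k \<in> ?A" using m p p0
        by (auto simp: k squarefree_avoiding_def squarefree_upto_def squarefree_prime_mult_iff field_simps)
      then show ?thesis using k by blast
    qed (use m in \<open>auto simp: squarefree_avoiding_def\<close>)
  next
    fix m assume m: "m \<in> squarefree_avoiding (insert p P) y \<union> (\<lambda>m. p * m) ` ?A"
    have ndvd: "\<not> q dvd p * k" if "q \<in> P" "\<not> q dvd k" for q k
      using primes_dvd_imp_eq[OF P(2)[OF that(1)] p] P that by (auto simp: prime_dvd_mult_iff)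
    from m show "m \<in> squarefree_avoiding P y"
    proof
      assume "m \<in> (\<lambda>m. p * m) ` ?A"
      then obtain k where k: "m = p * k" "k \<in> ?A" by blast
      then have "squarefree (k * p)"
        using squarefree_prime_mult_iff[OF p, of k]
        by (simp add: mult.commute squarefree_avoiding_def squarefree_upto_def)
      then show ?thesis using k ndvd p p0
        by (auto simp: squarefree_avoiding_def squarefree_upto_def squarefree_prime_mult_iff field_simps)
    qed (auto simp: squarefree_avoiding_def)
  qed
  moreover have "squarefree_avoiding (insert p P) y \<inter> (\<lambda>m. p * m) ` ?A = {}"
    by (auto simp: squarefree_avoiding_def)
  moreover have "inj_on (\<lambda>m. p * m) ?A" using p by (intro inj_onI) auto
  ultimately show ?thesis by (simp add: card_Un_disjoint card_image)
qed

text \<open>Solving the recursion for one new prime p by hand gives the alternating sum of the old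
  counts at y/p^j. The main terms then add up to the factor 1/(1 + 1/p) = p/(p + 1), while the
  errors, taken in absolute value, give 1/(1 - 1/sqrt p).\<close>

lemma card_squarefree_avoiding_approx:
  assumes a: "a > 0" "a \<le> 3"
    "\<And>y. y \<ge> 0 \<Longrightarrow> \<bar>real (card (squarefree_upto y)) - a * y\<bar> \<le> 3 * sqrt y"
  assumes "finite P" "\<And>p. p \<in> P \<Longrightarrow> prime p" "y \<ge> 0"
  shows "\<bar>real (card (squarefree_avoiding P y)) - a * (\<Prod>p\<in>P. real p / (real p + 1)) * y\<bar>
    \<le> 3 * (\<Prod>p\<in>P. 1 / (1 - 1 / sqrt (real p))) * sqrt y"
  using assms(4-)
proof (induction P arbitrary: y)
  case empty
  then show ?case using a(3)[of y] by (simp add: squarefree_avoiding_def)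
next
  case (insert p P)
  let ?Q = "\<lambda>y. real (card (squarefree_avoiding (insert p P) y))"
  define \<beta> where "\<beta> = a * (\<Prod>p\<in>P. real p / (real p + 1))"
  define \<beta>' where "\<beta>' = a * (\<Prod>p\<in>insert p P. real p / (real p + 1))"
  define E where "E = 3 * (\<Prod>p\<in>P. 1 / (1 - 1 / sqrt (real p)))"
  define E' where "E' = 3 * (\<Prod>p\<in>insert p P. 1 / (1 - 1 / sqrt (real p)))"
  have sq: "sqrt (real q) > 1" if "q \<in> insert p P" for q
    using insert.prems(1)[OF that] prime_gt_1_nat[of q] by simp
  have p: "prime p" "real p > 0" using insert.prems(1)[of p] prime_gt_0_nat[of p] by auto
  \<comment> \<open>The counts satisfy \<open>Q\<^sub>P(y) = Q\<^sub>P\<^sub>'(y) + Q\<^sub>P\<^sub>'(y/p)\<close> with \<open>P' = insert p P\<close>; \<open>E'\<close> is the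
    fixed point of the resulting recursion for the error constants.\<close>
  have E': "E' = E + E' / sqrt (real p)"
  proof -
    have "E' = E * (1 / (1 - 1 / sqrt (real p)))" using insert.hyps by (simp add: E_def E'_def)
    then have "E' * (1 - 1 / sqrt (real p)) = E" using sq[of p] by simp
    then show ?thesis by (simp add: algebra_simps)
  qed
  \<comment> \<open>This and the bound 3 on the density constant serve the range y < 1, where no
    squarefree number exists and the main term alone must stay below the error.\<close>
  have E3: "E' \<ge> 3"
  proof -
    have "(\<Prod>p\<in>insert p P. 1 / (1 - 1 / sqrt (real p))) \<ge> 1"
    proof (rule prod_ge_1)
      fix q assume "q \<in> insert p P"
      from sq[OF this] show "1 \<le> 1 / (1 - 1 / sqrt (real q))"
        by (simp add: field_simps)
    qed
    then show ?thesis by (simp add: E'_def)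
  qed
  have \<beta>': "\<beta>' + \<beta>' / real p = \<beta>"
  proof -
    have "\<beta>' = \<beta> * (real p / (real p + 1))" using insert.hyps by (simp add: \<beta>_def \<beta>'_def)
    then show ?thesis using p by (simp add: field_simps)
  qed
  have b3: "0 \<le> \<beta>'" "\<beta>' \<le> 3"
  proof -
    have "(\<Prod>p\<in>insert p P. real p / (real p + 1)) \<le> 1" by (intro prod_le_1) auto
    moreover have "(\<Prod>p\<in>insert p P. real p / (real p + 1)) \<ge> 0" by (intro prod_nonneg) auto
    ultimately have "a * (\<Prod>p\<in>insert p P. real p / (real p + 1)) \<le> 3 * 1"
      using a by (intro mult_mono) auto
    then show "\<beta>' \<le> 3" by (simp add: \<beta>'_def)
    show "0 \<le> \<beta>'" unfolding \<beta>'_def using a by (intro mult_nonneg_nonneg prod_nonneg) auto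
  qed
  \<comment> \<open>The count for the enlarged set appears on both sides of the recursion, at y and
    at y/p <= y/2; hence an inner induction on the dyadic size of y.\<close>
  have "\<bar>?Q y - \<beta>' * y\<bar> \<le> E' * sqrt y" if "y \<ge> 0" "y < 2 ^ n" for n :: nat and y
    using that
  proof (induction n arbitrary: y)
    case 0
    then have "squarefree_upto y = {}" using squarefree_uptoD(3,4) by force
    then have "squarefree_avoiding (insert p P) y = {}" by (simp add: squarefree_avoiding_def)
    moreover have "y \<le> sqrt y" using 0 by (intro real_le_rsqrt) (simp add: power2_eq_square mult_left_le)
    then have "\<beta>' * y \<le> E' * sqrt y" using E3 b3 0 by (intro mult_mono) auto
    ultimately show ?case using 0 b3 by simp
  next
    case (Suc n)
    have "y / real p \<le> y / 2" using prime_ge_2_nat[OF p(1)] Suc.prems by (intro divide_left_mono) auto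
    also have "y / 2 < 2 ^ n" using Suc.prems by simp
    finally have IH: "\<bar>?Q (y / real p) - \<beta>' * (y / real p)\<bar> \<le> E' * sqrt (y / real p)"
      using Suc.prems p by (intro Suc.IH) auto
    have "\<bar>real (card (squarefree_avoiding P y)) - \<beta> * y\<bar> \<le> E * sqrt y"
      unfolding \<beta>_def E_def using insert.prems Suc.prems by (intro insert.IH) auto
    moreover have "real (card (squarefree_avoiding P y)) = ?Q y + ?Q (y / real p)"
      using card_squarefree_avoiding_insert[of p P y] insert by auto
    moreover have "\<beta> * y = \<beta>' * y + \<beta>' * (y / real p)"
      by (simp add: \<beta>'[symmetric] algebra_simps)
    moreover have "E' * sqrt y = E * sqrt y + E' * sqrt (y / real p)"
      by (subst E') (simp add: real_sqrt_divide algebra_simps)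
    ultimately show ?case using IH by linarith
  qed
  moreover have "\<exists>n. y < 2 ^ n" by (rule real_arch_pow) simp
  ultimately show ?case using insert.prems unfolding \<beta>'_def E'_def by blast
qed

subsection \<open>The logarithmic mean of the weights\<close>

text \<open>For squarefree d this is c^omega(d) times the relative density of the multiples of d
  among the squarefree numbers.\<close>

definition prime_weight :: "real \<Rightarrow> nat \<Rightarrow> real" where
  "prime_weight c d = (\<Prod>p\<in>prime_factors d. c / (real p + 1))"

definition weight_sum :: "real \<Rightarrow> real \<Rightarrow> real" where
  "weight_sum c y = (\<Sum>d\<in>squarefree_upto y. prime_weight c d)"

definition log_weight_sum :: "real \<Rightarrow> real \<Rightarrow> real" where
  "log_weight_sum c y = (\<Sum>d\<in>squarefree_upto y. prime_weight c d * (ln y - ln (real d)))"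

lemma prime_weight_1 [simp]: "prime_weight c 1 = 1" "prime_weight c (Suc 0) = 1"
  by (simp_all add: prime_weight_def)

lemma prime_weight_nonneg: "c \<ge> 0 \<Longrightarrow> prime_weight c d \<ge> 0"
  by (auto simp: prime_weight_def intro!: prod_nonneg)

lemma prime_weight_prime_mult:
  assumes "prime p" "squarefree m" "\<not> p dvd m"
  shows "prime_weight c (p * m) = c / (real p + 1) * prime_weight c m"
proof -
  have "m > 0" using assms by (intro Nat.gr0I) auto
  then have "p \<notin> prime_factors m" "prime_factors (p * m) = insert p (prime_factors m)"
    using assms by (auto simp: prime_factors_prime_mult)
  then show ?thesis by (simp add: prime_weight_def)
qed

lemma weight_sum_mono: "c \<ge> 0 \<Longrightarrow> x \<le> y \<Longrightarrow> weight_sum c x \<le> weight_sum c y"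
  unfolding weight_sum_def by (intro sum_mono2 squarefree_upto_mono prime_weight_nonneg) auto

lemma weight_sum_ge_1:
  assumes "c \<ge> 0" "y \<ge> 1"
  shows "weight_sum c y \<ge> 1"
proof -
  have "1 = (\<Sum>d\<in>{1}. prime_weight c d)" by simp
  also have "\<dots> \<le> weight_sum c y"
    unfolding weight_sum_def using assms by (intro sum_mono2 prime_weight_nonneg) auto
  finally show ?thesis .
qed

lemma log_weight_sum_nonneg:
  assumes "c \<ge> 0"
  shows "log_weight_sum c y \<ge> 0"
  unfolding log_weight_sum_def
proof (intro sum_nonneg mult_nonneg_nonneg prime_weight_nonneg assms)
  fix d assume "d \<in> squarefree_upto y"
  then show "0 \<le> ln y - ln (real d)" using squarefree_uptoD[of d y] by simp
qed

text \<open>Between x and y, each d <= x gains exactly ln y - ln x and each d in (x, y] gains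
  something between 0 and that. These are the endpoint bounds for the integral of an increasing
  function.\<close>

lemma log_weight_sum_diff:
  assumes c: "c \<ge> 0" and xy: "1 \<le> x" "x \<le> y"
  shows "(ln y - ln x) * weight_sum c x \<le> log_weight_sum c y - log_weight_sum c x"
    "log_weight_sum c y - log_weight_sum c x \<le> (ln y - ln x) * weight_sum c y"
proof -
  let ?S = "squarefree_upto y - squarefree_upto x"
  have sub: "squarefree_upto x \<subseteq> squarefree_upto y" by (rule squarefree_upto_mono) fact
  have split: "sum f (squarefree_upto y) = sum f ?S + sum f (squarefree_upto x)" for f :: "nat \<Rightarrow> real"
    by (rule sum.subset_diff[OF sub]) simp
  have eq: "log_weight_sum c y - log_weight_sum c x =
    (\<Sum>d\<in>?S. prime_weight c d * (ln y - ln (real d))) + (ln y - ln x) * weight_sum c x"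
  proof -
    have "(\<Sum>d\<in>squarefree_upto x. prime_weight c d * (ln y - ln (real d))) =
      (\<Sum>d\<in>squarefree_upto x. prime_weight c d * (ln x - ln (real d)) + (ln y - ln x) * prime_weight c d)"
      by (intro sum.cong refl) (simp add: algebra_simps)
    also have "\<dots> = log_weight_sum c x + (ln y - ln x) * weight_sum c x"
      by (simp only: sum.distrib sum_distrib_left log_weight_sum_def weight_sum_def)
    finally show ?thesis
      using split[of "\<lambda>d. prime_weight c d * (ln y - ln (real d))"]
      by (simp add: log_weight_sum_def[of c y])
  qed
  have bnd: "0 \<le> ln y - ln (real d)" "ln y - ln (real d) \<le> ln y - ln x" if "d \<in> ?S" for d
  proof -
    have d: "d \<in> squarefree_upto y" "d \<notin> squarefree_upto x" using that by simp_all
    note squarefree_uptoD[OF d(1)]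
    moreover from this d(2) have "x < real d" by (simp add: squarefree_upto_def)
    ultimately show "0 \<le> ln y - ln (real d)" "ln y - ln (real d) \<le> ln y - ln x" using xy by simp_all
  qed
  have "0 \<le> (\<Sum>d\<in>?S. prime_weight c d * (ln y - ln (real d)))"
    using bnd c by (intro sum_nonneg mult_nonneg_nonneg prime_weight_nonneg) auto
  with eq show "(ln y - ln x) * weight_sum c x \<le> log_weight_sum c y - log_weight_sum c x" by linarith
  have "(\<Sum>d\<in>?S. prime_weight c d * (ln y - ln (real d))) \<le> (\<Sum>d\<in>?S. prime_weight c d * (ln y - ln x))"
    using bnd c by (intro sum_mono mult_left_mono prime_weight_nonneg) auto
  also have "\<dots> = (ln y - ln x) * (weight_sum c y - weight_sum c x)"
    unfolding weight_sum_def split by (simp add: sum_distrib_left mult.commute)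
  finally show "log_weight_sum c y - log_weight_sum c x \<le> (ln y - ln x) * weight_sum c y"
    using eq by (simp add: algebra_simps)
qed

text \<open>Since F = ln y * G - L with \<open>L\<close> the sum of w(d) ln d, it suffices that L =
  c F + O(G). Opening ln d over the primes of d and substituting d = p m leaves, for each m, a
  Mertens sum over p <= y/m, that is c (ln y - ln m) + O(1).\<close>

lemma log_weight_sum_approx:
  assumes c: "c \<ge> 0"
  shows "\<exists>A\<ge>0. \<forall>y\<ge>1. \<bar>(1 + c) * log_weight_sum c y - ln y * weight_sum c y\<bar> \<le> A * weight_sum c y"
proof -
  obtain A where A: "A \<ge> 0"
    "\<And>y. y \<ge> 1 \<Longrightarrow> \<bar>(\<Sum>p | prime p \<and> real p \<le> y. ln (real p) / (real p + 1)) - ln y\<bar> \<le> A"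
    using mertens_first by blast
  obtain B where B: "B \<ge> 0" "\<And>S. finite S \<Longrightarrow> (\<Sum>n\<in>S. ln (real n) / (real n)\<^sup>2) \<le> B"
    using sum_ln_over_square_bounded by blast
  have "\<bar>(1 + c) * log_weight_sum c y - ln y * weight_sum c y\<bar> \<le> (c * A + c * c * B) * weight_sum c y"
    if "y \<ge> 1" for y
  proof -
    let ?D = "squarefree_upto y" and ?w = "prime_weight c"
    let ?v = "\<lambda>p :: nat. c / (real p + 1)"
    let ?P = "\<lambda>m. {p. prime p \<and> real p \<le> y / real m}"
    let ?Q = "\<lambda>m. {p. prime p \<and> real p \<le> y / real m \<and> \<not> p dvd m}"
    let ?R = "\<lambda>m. {p. prime p \<and> real p \<le> y / real m \<and> p dvd m}"
    define L where "L = (\<Sum>d\<in>?D. ?w d * ln (real d))"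
    define M where "M = (\<Sum>m\<in>?D. ?w m * (\<Sum>p\<in>?P m. ?v p * ln (real p)))"
    define R where "R = (\<Sum>m\<in>?D. ?w m * (\<Sum>p\<in>?R m. ?v p * ln (real p)))"
    have finP: "finite (?P m)" for m
      by (rule finite_subset[OF _ finite_nat_real_le[of "y / real m"]]) auto
    have ln0: "ln (real p) \<ge> 0" if "prime p" for p
      using prime_ge_1_nat[OF that] by simp
    have w0: "?w m \<ge> 0" for m by (rule prime_weight_nonneg) fact
    have "L = (\<Sum>d\<in>?D. ?w d * (\<Sum>p\<in>prime_factors d. ln (real p)))"
      unfolding L_def using squarefree_uptoD(1) by (intro sum.cong refl) (simp add: ln_squarefree)
    also have "\<dots> = (\<Sum>m\<in>?D. ?w m * (\<Sum>p\<in>?Q m. ?v p * ln (real p)))"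
      by (rule sum_squarefree_prime_factors) (rule prime_weight_prime_mult)
    also have "\<dots> = M - R"
    proof -
      have "(\<Sum>p\<in>?P m. ?v p * ln (real p)) =
        (\<Sum>p\<in>?Q m. ?v p * ln (real p)) + (\<Sum>p\<in>?R m. ?v p * ln (real p))" for m
        by (subst sum.union_disjoint[symmetric])
           (auto intro!: sum.cong finite_subset[OF _ finP[of m]])
      then show ?thesis unfolding M_def R_def
        by (simp add: sum_subtractf[symmetric] algebra_simps)
    qed
    finally have LMR: "L = M - R" .
    have "0 \<le> R" unfolding R_def
      using ln0 c by (intro sum_nonneg mult_nonneg_nonneg w0) auto
    \<comment> \<open>With p <= y/m dropped, the inner sum runs over the primes of m, so the same
      substitution applies a second time. It produces a squared factor c/(p + 1) and thus a
      convergent sum.\<close>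
    have "R \<le> (\<Sum>m\<in>?D. ?w m * (\<Sum>p\<in>prime_factors m. ?v p * ln (real p)))"
      unfolding R_def using ln0 c
      by (intro sum_mono mult_left_mono w0 sum_mono2)
         (auto simp: prime_factors_dvd dest: squarefree_uptoD(2))
    also have "\<dots> = (\<Sum>m\<in>?D. ?w m * (\<Sum>p\<in>?Q m. ?v p * (?v p * ln (real p))))"
      by (rule sum_squarefree_prime_factors) (rule prime_weight_prime_mult)
    also have "\<dots> \<le> (\<Sum>m\<in>?D. ?w m * (c * c * B))"
    proof (intro sum_mono mult_left_mono w0)
      fix m
      have "(\<Sum>p\<in>?Q m. ?v p * (?v p * ln (real p))) \<le> (\<Sum>p\<in>?Q m. c * c * (ln (real p) / (real p)\<^sup>2))"
      proof (rule sum_mono)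
        fix p assume "p \<in> ?Q m"
        then have p: "prime p" by simp
        have "?v p * (?v p * ln (real p)) = c * c * (ln (real p) / (real p + 1)\<^sup>2)"
          by (simp add: power2_eq_square)
        also have "\<dots> \<le> c * c * (ln (real p) / (real p)\<^sup>2)"
          using ln0[OF p] prime_gt_0_nat[OF p]
          by (intro mult_left_mono divide_left_mono power_mono) auto
        finally show "?v p * (?v p * ln (real p)) \<le> c * c * (ln (real p) / (real p)\<^sup>2)" .
      qed
      also have "\<dots> = c * c * (\<Sum>p\<in>?Q m. ln (real p) / (real p)\<^sup>2)" by (simp add: sum_distrib_left)
      also have "\<dots> \<le> c * c * B"
        by (intro mult_left_mono B(2) finite_subset[OF _ finP[of m]]) auto
      finally show "(\<Sum>p\<in>?Q m. ?v p * (?v p * ln (real p))) \<le> c * c * B" .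
    qed
    also have "\<dots> = c * c * B * weight_sum c y"
      by (simp add: weight_sum_def sum_distrib_left mult_ac)
    finally have R: "R \<le> c * c * B * weight_sum c y" .
    have "M - c * log_weight_sum c y =
      (\<Sum>m\<in>?D. ?w m * (c * ((\<Sum>p\<in>?P m. ln (real p) / (real p + 1)) - (ln y - ln (real m)))))"
      unfolding M_def log_weight_sum_def
      by (simp add: sum_distrib_left sum_subtractf right_diff_distrib mult_ac)
    also have "\<bar>\<dots>\<bar> \<le> (\<Sum>m\<in>?D. ?w m * (c * A))"
    proof (rule order_trans[OF sum_abs], rule sum_mono)
      fix m assume m: "m \<in> ?D"
      have "\<bar>(\<Sum>p\<in>?P m. ln (real p) / (real p + 1)) - ln (y / real m)\<bar> \<le> A"
        using squarefree_uptoD[OF m] by (intro A(2)) (simp add: field_simps)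
      moreover have "ln (y / real m) = ln y - ln (real m)"
        using squarefree_uptoD[OF m] that by (simp add: ln_div)
      ultimately have "\<bar>(\<Sum>p\<in>?P m. ln (real p) / (real p + 1)) - (ln y - ln (real m))\<bar> \<le> A" by simp
      then show "\<bar>?w m * (c * ((\<Sum>p\<in>?P m. ln (real p) / (real p + 1)) - (ln y - ln (real m))))\<bar> \<le> ?w m * (c * A)"
        using c w0[of m] by (simp only: abs_mult abs_of_nonneg) (intro mult_left_mono; simp)
    qed
    also have "\<dots> = c * A * weight_sum c y"
      by (simp add: weight_sum_def sum_distrib_left mult_ac)
    finally have M: "\<bar>M - c * log_weight_sum c y\<bar> \<le> c * A * weight_sum c y" .
    have "log_weight_sum c y = ln y * weight_sum c y - L"
      by (simp add: log_weight_sum_def weight_sum_def L_def sum_distrib_left right_diff_distrib sum_subtractf mult_ac)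
    then have "(1 + c) * log_weight_sum c y - ln y * weight_sum c y = c * log_weight_sum c y - L"
      by (simp add: algebra_simps)
    then show ?thesis using LMR M R \<open>0 \<le> R\<close> by (simp add: distrib_right abs_le_iff)
  qed
  moreover have "c * A + c * c * B \<ge> 0" using A B c by auto
  ultimately show ?thesis by blast
qed

subsection \<open>Regular growth\<close>

text \<open>The base is 1 - (1 + c) L/n + O(1/n^2), so this is the compound interest limit.\<close>

lemma subdivision_limit:
  fixes L c :: real
  shows "(\<lambda>n. (1 - (1 + c) * (1 - exp (- (L / real n)))) ^ n) \<longlonglongrightarrow> exp (- ((1 + c) * L))"
  by real_asymp

text \<open>\<open>diff_ge\<close> and \<open>diff_le\<close> stand in for \<open>f' = g\<close>, which fails at the jumps of the step function \<open>g\<close>.\<close>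

locale regular_growth =
  fixes f g :: "real \<Rightarrow> real" and c A :: real
  assumes c_nonneg: "c \<ge> 0" and A_nonneg: "A \<ge> 0"
    and f_nonneg: "u \<ge> 0 \<Longrightarrow> f u \<ge> 0"
    and g_ge_1: "u \<ge> 0 \<Longrightarrow> g u \<ge> 1"
    and g_mono: "0 \<le> u \<Longrightarrow> u \<le> v \<Longrightarrow> g u \<le> g v"
    and diff_ge: "0 \<le> u \<Longrightarrow> u \<le> v \<Longrightarrow> (v - u) * g u \<le> f v - f u"
    and diff_le: "0 \<le> u \<Longrightarrow> u \<le> v \<Longrightarrow> f v - f u \<le> (v - u) * g v"
    and approx: "u \<ge> 0 \<Longrightarrow> \<bar>(1 + c) * f u - u * g u\<bar> \<le> A * g u"
begin

text \<open>Distances are measured from \<open>A\<close> so that v - u = (1 - t) (v - A):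
  \<open>diff_le\<close> then produces (v - A) * g v, which is exactly what \<open>approx\<close>
  bounds by (1 + c) * f v.\<close>

lemma contraction_step:
  assumes v: "v > A" and t: "0 \<le> t" "t \<le> 1"
  shows "f v * (1 - (1 + c) * (1 - t)) \<le> f (A + (v - A) * t)"
proof -
  define u where "u = A + (v - A) * t"
  have u: "0 \<le> u" "u \<le> v" "v - u = (1 - t) * (v - A)"
  proof -
    have "(v - A) * t \<ge> 0" "(v - A) * t \<le> v - A" using v t by (auto intro: mult_left_le)
    then show "0 \<le> u" "u \<le> v" using A_nonneg by (auto simp: u_def)
    show "v - u = (1 - t) * (v - A)" by (simp add: u_def algebra_simps)
  qed
  have "f v - f u \<le> (1 - t) * ((v - A) * g v)"
    using diff_le[OF u(1,2)] by (simp add: u(3) mult_ac)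
  also have "(v - A) * g v \<le> (1 + c) * f v"
    using approx[of v] v A_nonneg by (simp add: algebra_simps abs_le_iff)
  then have "(1 - t) * ((v - A) * g v) \<le> (1 - t) * ((1 + c) * f v)"
    using t by (intro mult_left_mono) auto
  finally show ?thesis by (simp add: u_def algebra_simps)
qed

lemma contraction_iterate:
  assumes v: "v > A" and t: "0 < t" "t \<le> 1" and q: "1 - (1 + c) * (1 - t) \<ge> 0"
  shows "f v * (1 - (1 + c) * (1 - t)) ^ n \<le> f (A + (v - A) * t ^ n)"
proof (induction n)
  case (Suc n)
  let ?q = "1 - (1 + c) * (1 - t)"
  have "f v * ?q ^ Suc n \<le> f (A + (v - A) * t ^ n) * ?q"
    using mult_right_mono[OF Suc q] by (simp add: mult_ac)
  also have "\<dots> \<le> f (A + (A + (v - A) * t ^ n - A) * t)"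
    using v t by (intro contraction_step) auto
  finally show ?case by (simp add: mult_ac)
qed simp

text \<open>Each contraction step loses a second-order term; subdividing \<open>L\<close> into \<open>n \<longlongrightarrow> \<infinity>\<close> equal steps
  removes the loss and gives the sharp exponent \<open>1 + c\<close>.\<close>

lemma f_ratio:
  assumes v: "v > A" and L: "L \<ge> 0"
  shows "f v * exp (- ((1 + c) * L)) \<le> f (A + (v - A) * exp (- L))"
proof -
  let ?q = "\<lambda>n. 1 - (1 + c) * (1 - exp (- (L / real n)))"
  have "?q \<longlonglongrightarrow> 1" by real_asymp
  then have "eventually (\<lambda>n. ?q n > 0) sequentially" by (rule order_tendstoD) simp
  then have ev: "eventually (\<lambda>n. f v * ?q n ^ n \<le> f (A + (v - A) * exp (- L))) sequentially"
    using eventually_gt_at_top[of 0]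
  proof eventually_elim
    case (elim n)
    have "f v * ?q n ^ n \<le> f (A + (v - A) * exp (- (L / real n)) ^ n)"
      using elim L v by (intro contraction_iterate) auto
    also have "exp (- (L / real n)) ^ n = exp (- L)"
      using elim by (simp add: exp_of_nat_mult[symmetric])
    finally show ?case .
  qed
  have "(\<lambda>n. f v * ?q n ^ n) \<longlonglongrightarrow> f v * exp (- ((1 + c) * L))"
    by (intro tendsto_mult tendsto_const subdivision_limit)
  then show ?thesis using ev by (rule tendsto_upperbound) simp
qed

text \<open>The ratio bound for \<open>f\<close> is transferred by \<open>approx\<close> at both
  ends: (k u - A) g(k u) <= (1 + c) f(k u) and (1 + c) f(u) <= (u + A) g(u). The transfer
  contributes 1/k in the limit, lowering the exponent from 1 + c to c.\<close>

lemma g_ratio: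
  assumes k: "k > 1" and lam: "k powr c < lam"
  shows "eventually (\<lambda>u. g (k * u) \<le> lam * g u) at_top"
proof -
  \<comment> \<open>\<open>?K u\<close> is chosen so that shrinking the distance of k u from
    \<open>A\<close> by this factor lands exactly on u.\<close>
  let ?K = "\<lambda>u. (k * u - A) / (u - A)" and ?R = "\<lambda>u. (u + A) / (k * u - A)"
  have "(?K \<longlongrightarrow> k) at_top" using k by real_asymp
  moreover have "(?R \<longlongrightarrow> inverse k) at_top" using k by real_asymp
  ultimately have "((\<lambda>u. ?K u powr (1 + c) * ?R u) \<longlongrightarrow> k powr (1 + c) * inverse k) at_top"
    using k by (intro tendsto_mult tendsto_powr tendsto_const) auto
  also have "k powr (1 + c) * inverse k = k powr c" using k by (simp only: powr_add) (simp add: field_simps)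
  finally have "eventually (\<lambda>u. ?K u powr (1 + c) * ?R u < lam) at_top"
    using lam by (rule order_tendstoD)
  then show ?thesis using eventually_gt_at_top[of A]
  proof eventually_elim
    case (elim u)
    define K where "K = ?K u"
    have u0: "u > 0" using elim A_nonneg by simp
    have ku: "k * u > u" using k u0 by simp
    have K1: "K \<ge> 1" using elim ku by (simp add: K_def field_simps)
    have "f (k * u) * exp (- ((1 + c) * ln K)) \<le> f (A + (k * u - A) * exp (- ln K))"
      using elim ku K1 by (intro f_ratio) auto
    also have "A + (k * u - A) * exp (- ln K) = u"
      using K1 elim ku by (simp add: exp_minus K_def)
    also have "exp (- ((1 + c) * ln K)) = inverse (K powr (1 + c))"
      using K1 by (simp add: powr_def exp_minus)
    finally have fK: "f (k * u) \<le> K powr (1 + c) * f u"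
      using K1 by (simp add: field_simps)
    have "(k * u - A) * g (k * u) \<le> (1 + c) * f (k * u)"
      using approx[of "k * u"] u0 ku by (simp add: algebra_simps abs_le_iff)
    also have "\<dots> \<le> (1 + c) * (K powr (1 + c) * f u)"
      using fK c_nonneg by (intro mult_left_mono) auto
    also have "\<dots> = K powr (1 + c) * ((1 + c) * f u)" by simp
    also have "\<dots> \<le> K powr (1 + c) * ((u + A) * g u)"
      using approx[of u] u0 by (intro mult_left_mono) (auto simp: algebra_simps abs_le_iff)
    finally have "g (k * u) \<le> K powr (1 + c) * ?R u * g u"
      using elim ku by (simp add: field_simps)
    also have "\<dots> \<le> lam * g u"
      using elim g_ge_1[of u] u0 by (intro mult_right_mono) (auto simp: K_def)
    finally show ?case .
  qed
qed

text \<open>The value g u forces f v >= (v - u) g u for all later v, and \<open>approx\<close> turns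
  this into g v >= (1 + c) (v - u)/(v + A) g u. For large v the factor exceeds 1 + c/2, so g grows
  by a fixed factor again and again.\<close>

lemma g_at_top:
  assumes c: "c > 0"
  shows "filterlim g at_top at_top"
proof -
  have step: "\<exists>v\<ge>0. (1 + c / 2) * g u \<le> g v" if u: "u \<ge> 0" for u
  proof -
    have "((\<lambda>v. (1 + c) * (v - u) / (v + A)) \<longlongrightarrow> 1 + c) at_top" by real_asymp
    then have "eventually (\<lambda>v. (1 + c) * (v - u) / (v + A) > 1 + c / 2) at_top"
      using c by (intro order_tendstoD) auto
    then have "eventually (\<lambda>v. (1 + c) * (v - u) / (v + A) > 1 + c / 2 \<and> v > u) at_top"
      using eventually_gt_at_top[of u] by (rule eventually_conj)
    then obtain v where v: "(1 + c) * (v - u) / (v + A) > 1 + c / 2" "v > u"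
      by (auto dest: eventually_happens)
    have vA: "v + A > 0" using u v A_nonneg by simp
    have "(1 + c) * (v - u) * g u \<le> (1 + c) * (f v - f u)"
      using diff_ge[of u v] u v c by (simp add: mult.assoc)
    also have "\<dots> \<le> (1 + c) * f v" using f_nonneg[OF u] c by simp
    also have "\<dots> \<le> (v + A) * g v"
      using approx[of v] u v by (simp add: algebra_simps abs_le_iff)
    finally have "(1 + c) * (v - u) / (v + A) * g u \<le> g v"
      using vA by (simp add: field_simps)
    moreover have "(1 + c / 2) * g u \<le> (1 + c) * (v - u) / (v + A) * g u"
      using v g_ge_1[OF u] by (intro mult_right_mono) auto
    ultimately show ?thesis using u v by (intro exI[of _ v]) auto
  qed
  have pow: "\<exists>v\<ge>0. (1 + c / 2) ^ n \<le> g v" for n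
  proof (induction n)
    case 0
    show ?case using g_ge_1[of 0] by (intro exI[of _ 0]) auto
  next
    case (Suc n)
    then obtain u where u: "u \<ge> 0" "(1 + c / 2) ^ n \<le> g u" by blast
    from step[OF u(1)] obtain v where v: "v \<ge> 0" "(1 + c / 2) * g u \<le> g v" by blast
    have "(1 + c / 2) ^ Suc n \<le> (1 + c / 2) * g u" using u c by simp
    with v show ?case by (intro exI[of _ v]) auto
  qed
  show ?thesis unfolding filterlim_at_top
  proof
    fix Z :: real
    obtain n where "Z < (1 + c / 2) ^ n" using real_arch_pow[of "1 + c / 2" Z] c by auto
    moreover obtain v where "v \<ge> 0" "(1 + c / 2) ^ n \<le> g v" using pow[of n] by blast
    ultimately have "Z \<le> g u" if "u \<ge> v" for u using g_mono[of v u] that by simp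
    then show "eventually (\<lambda>u. Z \<le> g u) at_top" using eventually_ge_at_top[of v] by (rule eventually_mono[rotated])
  qed
qed

end

section \<open>Growth of the partial sums of the weights\<close>

lemma weight_sum_growth:
  assumes c: "c \<ge> 0"
  shows "\<exists>A. regular_growth (\<lambda>u. log_weight_sum c (exp u)) (\<lambda>u. weight_sum c (exp u)) c A"
proof -
  obtain A where A: "A \<ge> 0"
    "\<And>y. y \<ge> 1 \<Longrightarrow> \<bar>(1 + c) * log_weight_sum c y - ln y * weight_sum c y\<bar> \<le> A * weight_sum c y"
    using log_weight_sum_approx[OF c] by blast
  have "regular_growth (\<lambda>u. log_weight_sum c (exp u)) (\<lambda>u. weight_sum c (exp u)) c A"
  proof
    fix u :: real assume u: "u \<ge> 0"
    show "\<bar>(1 + c) * log_weight_sum c (exp u) - u * weight_sum c (exp u)\<bar> \<le> A * weight_sum c (exp u)"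
      using A(2)[of "exp u"] u by simp
  next
    fix u v :: real assume "0 \<le> u" "u \<le> v"
    then show "(v - u) * weight_sum c (exp u) \<le> log_weight_sum c (exp v) - log_weight_sum c (exp u)"
      "log_weight_sum c (exp v) - log_weight_sum c (exp u) \<le> (v - u) * weight_sum c (exp v)"
      using log_weight_sum_diff[OF c, of "exp u" "exp v"] by simp_all
  qed (use c A(1) in \<open>auto intro: log_weight_sum_nonneg weight_sum_ge_1 weight_sum_mono\<close>)
  then show ?thesis by blast
qed

lemma weight_sum_ratio:
  assumes c: "c \<ge> 0" and k: "k > 1" and lam: "k powr c < lam"
  shows "eventually (\<lambda>x. weight_sum c x \<le> lam * weight_sum c (x powr (1 / k))) at_top"
proof -
  obtain A where "regular_growth (\<lambda>u. log_weight_sum c (exp u)) (\<lambda>u. weight_sum c (exp u)) c A"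
    using weight_sum_growth[OF c] by blast
  from regular_growth.g_ratio[OF this k lam]
  have "eventually (\<lambda>u. weight_sum c (exp (k * u)) \<le> lam * weight_sum c (exp u)) at_top" .
  moreover have "filterlim (\<lambda>x. ln x / k) at_top at_top" using k by real_asymp
  ultimately have "eventually (\<lambda>x. weight_sum c (exp (k * (ln x / k))) \<le> lam * weight_sum c (exp (ln x / k))) at_top"
    by (rule eventually_compose_filterlim)
  then show ?thesis using eventually_gt_at_top[of 0]
  proof eventually_elim
    case (elim x)
    then show ?case using k by (simp add: powr_def)
  qed
qed

lemma weight_sum_at_top:
  assumes c: "c > 0"
  shows "filterlim (weight_sum c) at_top at_top"
proof -
  obtain A where "regular_growth (\<lambda>u. log_weight_sum c (exp u)) (\<lambda>u. weight_sum c (exp u)) c A"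
    using weight_sum_growth[of c] c by auto
  from regular_growth.g_at_top[OF this c]
  have "filterlim (\<lambda>x. weight_sum c (exp (ln x))) at_top at_top"
    by (rule filterlim_compose) (rule ln_at_top)
  also have "?this \<longleftrightarrow> ?thesis"
    by (intro filterlim_cong refl eventually_mono[OF eventually_gt_at_top[of 0]]) simp
  finally show ?thesis .
qed

subsection \<open>Sums over divisors\<close>

lemma multiplicative_fun_squarefree:
  assumes h: "multiplicative_fun h" "\<And>p. prime p \<Longrightarrow> h p = c"
    and d: "squarefree d"
  shows "h d = c ^ card (prime_factors d)"
  using d
proof (induction d rule: less_induct)
  case (less d)
  show ?case
  proof (cases "d = 1")
    case True
    then show ?thesis using h(1) by (simp add: multiplicative_fun_def)
  next
    case False
    then obtain p where p: "prime p" "p dvd d" using prime_factor_nat by blast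
    then obtain m where m: "d = p * m" by (auto elim: dvdE)
    have sf: "squarefree m" "\<not> p dvd m"
      using less.prems squarefree_prime_mult_iff[OF p(1), of m] by (auto simp: m)
    then have m0: "m > 0" by (intro Nat.gr0I) auto
    have "m < d" using prime_gt_1_nat[OF p(1)] m0 by (simp add: m)
    then have "h m = c ^ card (prime_factors m)" using less.IH sf by blast
    moreover have "h (p * m) = h p * h m"
      using h(1) p sf m0 prime_gt_0_nat[OF p(1)] unfolding multiplicative_fun_def
      by (metis prime_imp_coprime)
    moreover have "p \<notin> prime_factors m" "prime_factors d = insert p (prime_factors m)"
      using p sf m0 by (auto simp: m prime_factors_prime_mult)
    ultimately show ?thesis using h(2)[OF p(1)] by (simp add: m)
  qed
qed

text \<open>For consecutive roots a <= b, 1 = (b - a) (b + a) <= 2 b (b - a), so 1/b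
  telescopes.\<close>

lemma sum_inverse_sqrt_le: "(\<Sum>d=1..n. 1 / sqrt (real d)) \<le> 2 * sqrt (real n)"
proof (induction n)
  case (Suc n)
  let ?a = "sqrt (real n)" and ?b = "sqrt (real (Suc n))"
  have b: "?b > 0" "?a \<le> ?b" "?a \<ge> 0" by auto
  have "(?b - ?a) * (?b + ?a) = 1" by (simp add: algebra_simps)
  also have "\<dots> = (1 / ?b) * ?b" using b by simp
  finally have "(1 / ?b) * ?b \<le> (?b - ?a) * (2 * ?b)"
    using b mult_left_mono[of "?b + ?a" "2 * ?b" "?b - ?a"] by simp
  then have "1 / ?b * ?b \<le> 2 * (?b - ?a) * ?b" by (simp only: mult_ac)
  then have "1 / ?b \<le> 2 * (?b - ?a)" using b(1) by (rule mult_right_le_imp_le)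
  then show ?case using Suc by simp
qed simp

lemma squarefree_upto_subset: "squarefree_upto x \<subseteq> {1..nat \<lfloor>x\<rfloor>}"
proof
  fix d assume "d \<in> squarefree_upto x"
  from squarefree_uptoD(2,4)[OF this] show "d \<in> {1..nat \<lfloor>x\<rfloor>}"
    by (simp add: le_nat_floor Suc_le_eq)
qed

lemma card_squarefree_upto_le:
  assumes "x \<ge> 0"
  shows "real (card (squarefree_upto x)) \<le> x"
proof -
  have "card (squarefree_upto x) \<le> card {1..nat \<lfloor>x\<rfloor>}"
    by (intro card_mono squarefree_upto_subset) auto
  then have "real (card (squarefree_upto x)) \<le> real (nat \<lfloor>x\<rfloor>)" by simp
  also have "\<dots> \<le> x" using assms by simp
  finally show ?thesis .
qed

text \<open>Square-root errors in the counts of multiples add up to O(x) without a logarithm, so any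
  unbounded growth of \<open>weight_sum\<close> outweighs them.\<close>

lemma sum_squarefree_sqrt_le:
  assumes "x \<ge> 0"
  shows "(\<Sum>d\<in>squarefree_upto x. sqrt (x / real d)) \<le> 2 * x"
proof -
  let ?n = "nat \<lfloor>x\<rfloor>"
  have "(\<Sum>d\<in>squarefree_upto x. sqrt (x / real d)) \<le> (\<Sum>d=1..?n. sqrt (x / real d))"
    using squarefree_upto_subset assms by (intro sum_mono2) auto
  also have "\<dots> = sqrt x * (\<Sum>d=1..?n. 1 / sqrt (real d))"
    by (simp add: sum_distrib_left real_sqrt_divide)
  also have "\<dots> \<le> sqrt x * (2 * sqrt (real ?n))"
    using sum_inverse_sqrt_le[of ?n] assms by (intro mult_left_mono) auto
  also have "\<dots> \<le> sqrt x * (2 * sqrt x)"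
    using assms by (intro mult_left_mono real_sqrt_le_mono) auto
  also have "\<dots> = 2 * x" using assms by simp
  finally show ?thesis .
qed

lemma card_squarefree_multiples:
  assumes d: "squarefree d"
  shows "card {n \<in> squarefree_upto x. d dvd n} =
    card (squarefree_avoiding (prime_factors d) (x / real d))"
proof -
  have d0: "d > 0" using d by (intro Nat.gr0I) auto
  have cop: "coprime d m \<longleftrightarrow> (\<forall>p\<in>prime_factors d. \<not> p dvd m)" for m
  proof
    assume "coprime d m"
    then show "\<forall>p\<in>prime_factors d. \<not> p dvd m"
      by (metis coprime_common_divisor_nat in_prime_factors_iff not_prime_1)
  next
    assume R: "\<forall>p\<in>prime_factors d. \<not> p dvd m"
    show "coprime d m"
    proof (rule ccontr)
      assume "\<not> coprime d m"
      then have "gcd d m \<noteq> 1" by (simp add: coprime_iff_gcd_eq_1)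
      then obtain p where "prime p" "p dvd gcd d m" using prime_factor_nat by blast
      then show False using R d0 by (auto simp: prime_factors_dvd)
    qed
  qed
  have sf: "squarefree (d * m) \<longleftrightarrow> squarefree m \<and> coprime d m" for m
  proof
    assume sq: "squarefree (d * m)"
    have "coprime d m"
    proof (rule ccontr)
      assume "\<not> coprime d m"
      then have "gcd d m \<noteq> 1" by (simp add: coprime_iff_gcd_eq_1)
      then obtain p where p: "prime p" "p dvd gcd d m" using prime_factor_nat by blast
      then have "p\<^sup>2 dvd d * m" by (simp add: power2_eq_square mult_dvd_mono)
      with sq have "p dvd 1" by (rule squarefreeD)
      with p show False by auto
    qed
    with squarefree_multD(2)[OF sq] show "squarefree m \<and> coprime d m" by blast
  qed (use d in \<open>auto intro: squarefree_mult_coprime\<close>)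
  have "{n \<in> squarefree_upto x. d dvd n} =
    (\<lambda>m. d * m) ` squarefree_avoiding (prime_factors d) (x / real d)"
  proof (intro equalityI subsetI)
    fix n assume n: "n \<in> {n \<in> squarefree_upto x. d dvd n}"
    then obtain m where m: "n = d * m" by (auto elim: dvdE)
    then have "squarefree (d * m)" "real d * real m \<le> x" using n by (auto simp: squarefree_upto_def)
    then have "m \<in> squarefree_upto (x / real d)" "coprime d m"
      using sf[of m] d0 squarefree_multD(2)[of d m] by (auto simp: squarefree_upto_def pos_le_divide_eq mult.commute)
    then have "m \<in> squarefree_avoiding (prime_factors d) (x / real d)"
      unfolding squarefree_avoiding_def using cop by blast
    then show "n \<in> (\<lambda>m. d * m) ` squarefree_avoiding (prime_factors d) (x / real d)"
      using m by blast
  next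
    fix n assume "n \<in> (\<lambda>m. d * m) ` squarefree_avoiding (prime_factors d) (x / real d)"
    then obtain m where m: "n = d * m" "m \<in> squarefree_avoiding (prime_factors d) (x / real d)" by blast
    then have "squarefree m" "coprime d m" "real m \<le> x / real d"
      unfolding cop by (auto simp: squarefree_avoiding_def squarefree_upto_def)
    then have "squarefree (d * m)" "real d * real m \<le> x"
      using sf[of m] d0 by (blast, simp add: pos_le_divide_eq mult.commute)
    then show "n \<in> {n \<in> squarefree_upto x. d dvd n}" using m by (simp add: squarefree_upto_def)
  qed
  moreover have "inj_on (\<lambda>m. d * m) A" for A using d0 by (intro inj_onI) auto
  ultimately show ?thesis by (simp add: card_image)
qed

text \<open>For p >= 4 the factor is at most 1/2 * 2 = 1, as sqrt p >= 2. Only 2 and 3 can exceed 1,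
  and each contributes at most 1/2 * 4 = 2 because sqrt p >= 4/3.\<close>

lemma prod_prime_bound:
  assumes c: "0 \<le> c" "c \<le> 1/2" and P: "finite P" "\<And>p. p \<in> P \<Longrightarrow> prime p"
  shows "(\<Prod>p\<in>P. c * (1 / (1 - 1 / sqrt (real p)))) \<le> 4"
proof -
  let ?f = "\<lambda>p. c * (1 / (1 - 1 / sqrt (real p)))"
  have sq: "1 / sqrt (real p) \<le> 3 / 4" if "p \<in> P" for p
  proof -
    have "4 / 3 \<le> sqrt (real p)"
      using prime_ge_2_nat[OF P(2)[OF that]] by (intro real_le_rsqrt) (simp add: power2_eq_square)
    then have "1 / sqrt (real p) \<le> 1 / (4 / 3)" by (intro frac_le) auto
    then show ?thesis by simp
  qed
  have nn: "?f p \<ge> 0" if "p \<in> P" for p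
    using sq[OF that] c by simp
  have "?f p \<le> 2" if "p \<in> P" for p
  proof -
    have "1 / (1 - 1 / sqrt (real p)) \<le> 1 / (1/4)"
      using sq[OF that] by (intro divide_left_mono) auto
    then have "?f p \<le> 1/2 * 4" using c sq[OF that] by (intro mult_mono) auto
    then show ?thesis by simp
  qed
  then have "(\<Prod>p\<in>P \<inter> {2, 3}. ?f p) \<le> (\<Prod>p\<in>P \<inter> {2, 3}. 2)"
    using nn by (intro prod_mono) auto
  also have "\<dots> = 2 ^ card (P \<inter> {2, 3})" by simp
  also have "\<dots> \<le> 2 ^ 2"
    using card_mono[of "{2, 3 :: nat}" "P \<inter> {2, 3}"] by (intro power_increasing) auto
  finally have 1: "(\<Prod>p\<in>P \<inter> {2, 3}. ?f p) \<le> 4" by simp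
  have 2: "(\<Prod>p\<in>P - {2, 3}. ?f p) \<le> 1"
  proof (rule prod_le_1)
    fix p assume p: "p \<in> P - {2, 3}"
    then have "p \<ge> 2" "p \<noteq> 2" "p \<noteq> 3" using prime_ge_2_nat[OF P(2)] by auto
    then have "4 \<le> p" by linarith
    then have "2 \<le> sqrt (real p)" by (intro real_le_rsqrt) simp
    then have "1 / sqrt (real p) \<le> 1 / 2" by (intro frac_le) auto
    then have "1 / (1 - 1 / sqrt (real p)) \<le> 1 / (1/2)" by (intro divide_left_mono) auto
    then have "?f p \<le> 1/2 * 2" using c sq[of p] p by (intro mult_mono) auto
    then show "0 \<le> ?f p \<and> ?f p \<le> 1" using nn[of p] p by auto
  qed
  have "prod ?f P = prod ?f (P \<inter> {2, 3}) * prod ?f (P - {2, 3})"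
    using P(1) by (subst prod.union_disjoint[symmetric]) (auto intro!: prod.cong)
  also have "\<dots> \<le> 4 * 1" using 1 2 nn by (intro mult_mono prod_nonneg) auto
  finally show ?thesis by simp
qed

text \<open>Multiplying the count by c^omega(d) turns its density into the weight and makes the
  error uniform in d apart from the square root; 12 is 3 times the bound 4 on the product over
  primes.\<close>

lemma weighted_squarefree_multiples:
  assumes a: "a > 0" "a \<le> 3"
    "\<And>y. y \<ge> 0 \<Longrightarrow> \<bar>real (card (squarefree_upto y)) - a * y\<bar> \<le> 3 * sqrt y"
  assumes c: "0 \<le> c" "c \<le> 1/2" and d: "squarefree d" and x: "x \<ge> 0"
  shows "\<bar>c ^ card (prime_factors d) * real (card {n \<in> squarefree_upto x. d dvd n}) -
    a * x * prime_weight c d\<bar> \<le> 12 * sqrt (x / real d)"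
proof -
  let ?P = "prime_factors d"
  let ?\<beta> = "a * (\<Prod>p\<in>?P. real p / (real p + 1))"
  have cn: "c ^ card ?P \<ge> 0" using c by simp
  have d0: "real d > 0" using d by (cases d) auto
  have dP: "real d = (\<Prod>p\<in>?P. real p)"
    using arg_cong[OF prod_prime_factors_squarefree[OF d], of real] by simp
  have "c ^ card ?P * (\<Prod>p\<in>?P. real p / (real p + 1)) = (\<Prod>p\<in>?P. c * (real p / (real p + 1)))"
    by (simp only: prod.distrib prod_constant)
  also have "\<dots> = (\<Prod>p\<in>?P. real p * (c / (real p + 1)))"
    by (intro prod.cong refl) simp
  also have "\<dots> = real d * prime_weight c d" by (simp only: prod.distrib dP prime_weight_def)
  finally have main: "c ^ card ?P * (?\<beta> * (x / real d)) = a * x * prime_weight c d"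
    using d0 by (simp add: field_simps)
  have "\<bar>real (card (squarefree_avoiding ?P (x / real d))) - ?\<beta> * (x / real d)\<bar>
    \<le> 3 * (\<Prod>p\<in>?P. 1 / (1 - 1 / sqrt (real p))) * sqrt (x / real d)"
    using x d0 by (intro card_squarefree_avoiding_approx a) auto
  from mult_left_mono[OF this cn]
  have "\<bar>c ^ card ?P * real (card (squarefree_avoiding ?P (x / real d))) - c ^ card ?P * (?\<beta> * (x / real d))\<bar>
    \<le> c ^ card ?P * (3 * (\<Prod>p\<in>?P. 1 / (1 - 1 / sqrt (real p))) * sqrt (x / real d))"
    using cn by (simp only: right_diff_distrib[symmetric] abs_mult abs_of_nonneg)
  also have "\<dots> = 3 * (\<Prod>p\<in>?P. c * (1 / (1 - 1 / sqrt (real p)))) * sqrt (x / real d)"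
    by (simp only: prod.distrib prod_constant mult_ac)
  also have "\<dots> \<le> 3 * 4 * sqrt (x / real d)"
    using x c by (intro mult_right_mono mult_left_mono prod_prime_bound) auto
  finally show ?thesis unfolding main card_squarefree_multiples[OF d] by simp
qed

section \<open>Exchanging the sums and comparing the two sides\<close>

text \<open>The predicate \<open>P\<close> lets one exchange serve both the full and the restricted
  divisor sum. The divisors of a squarefree n <= x are themselves squarefree and at most x.\<close>

lemma sum_squarefree_divisors:
  "(\<Sum>n\<in>squarefree_upto x. \<Sum>d | d dvd n \<and> P n d. f d) =
    (\<Sum>d\<in>squarefree_upto x. f d * real (card {n \<in> squarefree_upto x. d dvd n \<and> P n d}))"
proof -
  have "(\<Sum>n\<in>squarefree_upto x. \<Sum>d | d dvd n \<and> P n d. f d) =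
    (\<Sum>n\<in>squarefree_upto x. \<Sum>d\<in>squarefree_upto x. f d * of_bool (d dvd n \<and> P n d))"
  proof (rule sum.cong[OF refl])
    fix n assume n: "n \<in> squarefree_upto x"
    have "d \<in> squarefree_upto x" if "d dvd n" for d
      using that squarefree_uptoD[OF n] squarefree_mono[OF that] dvd_imp_le[OF that]
      by (force simp: squarefree_upto_def)
    then show "(\<Sum>d | d dvd n \<and> P n d. f d) = (\<Sum>d\<in>squarefree_upto x. f d * of_bool (d dvd n \<and> P n d))"
      by (intro sum.mono_neutral_cong_left) auto
  qed
  also have "\<dots> = (\<Sum>d\<in>squarefree_upto x. \<Sum>n\<in>squarefree_upto x. f d * of_bool (d dvd n \<and> P n d))"
    by (rule sum.swap)
  also have "\<dots> = (\<Sum>d\<in>squarefree_upto x. f d * real (card {n \<in> squarefree_upto x. d dvd n \<and> P n d}))"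
    by (simp add: sum_distrib_left[symmetric] Int_def)
  finally show ?thesis .
qed

lemma sum_moebius_mu_squared:
  "(\<Sum>n | n > 0 \<and> real n \<le> x. (moebius_mu n)\<^sup>2 * f n) = (\<Sum>n\<in>squarefree_upto x. f n)"
  unfolding moebius_mu_squared
  by (intro sum.mono_neutral_cong_right finite_subset[OF _ finite_nat_real_le[of x]])
     (auto simp: squarefree_upto_def intro: Nat.gr0I)

lemma full_sum_upper:
  assumes a: "a > 0" "a \<le> 3"
    "\<And>y. y \<ge> 0 \<Longrightarrow> \<bar>real (card (squarefree_upto y)) - a * y\<bar> \<le> 3 * sqrt y"
  assumes c: "0 \<le> c" "c \<le> 1/2" and x: "x \<ge> 0"
  shows "(\<Sum>n\<in>squarefree_upto x. \<Sum>d | d dvd n. c ^ card (prime_factors d))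
    \<le> a * x * weight_sum c x + 24 * x"
proof -
  have "(\<Sum>n\<in>squarefree_upto x. \<Sum>d | d dvd n. c ^ card (prime_factors d)) =
    (\<Sum>d\<in>squarefree_upto x. c ^ card (prime_factors d) * real (card {n \<in> squarefree_upto x. d dvd n}))"
    using sum_squarefree_divisors[where P = "\<lambda>_ _. True"] by simp
  also have "\<dots> \<le> (\<Sum>d\<in>squarefree_upto x. a * x * prime_weight c d + 12 * sqrt (x / real d))"
  proof (rule sum_mono)
    fix d assume "d \<in> squarefree_upto x"
    from weighted_squarefree_multiples[OF a c squarefree_uptoD(1)[OF this] x]
    show "c ^ card (prime_factors d) * real (card {n \<in> squarefree_upto x. d dvd n})
      \<le> a * x * prime_weight c d + 12 * sqrt (x / real d)" by linarith
  qed
  also have "\<dots> = a * x * weight_sum c x + 12 * (\<Sum>d\<in>squarefree_upto x. sqrt (x / real d))"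
    by (simp add: sum.distrib sum_distrib_left weight_sum_def)
  also have "\<dots> \<le> a * x * weight_sum c x + 24 * x" using sum_squarefree_sqrt_le[OF x] by simp
  finally show ?thesis .
qed

text \<open>The multiples n < d^k are those that the condition d <= n^(1/k) removes.\<close>

lemma card_multiples_below_power:
  assumes "d > 0" "k > 0"
  shows "card {n \<in> squarefree_upto x. d dvd n \<and> n < d ^ k} \<le> d ^ (k - 1)"
proof -
  have "{n \<in> squarefree_upto x. d dvd n \<and> n < d ^ k} \<subseteq> (\<lambda>j. d * j) ` {..<d ^ (k - 1)}"
  proof
    fix n assume n: "n \<in> {n \<in> squarefree_upto x. d dvd n \<and> n < d ^ k}"
    then obtain j where j: "n = d * j" by (auto elim: dvdE)
    have "d ^ k = d * d ^ (k - 1)" using assms by (simp add: power_eq_if)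
    then have "j < d ^ (k - 1)" using n assms by (simp add: j)
    then show "n \<in> (\<lambda>j. d * j) ` {..<d ^ (k - 1)}" using j by blast
  qed
  then have "card {n \<in> squarefree_upto x. d dvd n \<and> n < d ^ k} \<le> card ((\<lambda>j. d * j) ` {..<d ^ (k - 1)})"
    by (intro card_mono) auto
  also have "\<dots> \<le> d ^ (k - 1)" using card_image_le[of "{..<d ^ (k - 1)}" "\<lambda>j. d * j"] by simp
  finally show ?thesis .
qed

text \<open>The constant 25 is 12 * 2 from the square-root errors plus 1 from the removed multiples:
  with z = x^(1/k) there are at most z values of d, each losing at most z^(k-1), and z * z^(k-1) =
  x.\<close>

lemma small_sum_lower:
  fixes k :: nat
  assumes a: "a > 0" "a \<le> 3"
    "\<And>y. y \<ge> 0 \<Longrightarrow> \<bar>real (card (squarefree_upto y)) - a * y\<bar> \<le> 3 * sqrt y"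
  assumes c: "0 \<le> c" "c \<le> 1/2" and x: "x \<ge> 1" and k: "k > 0"
  shows "a * x * weight_sum c (x powr (1 / real k)) - 25 * x
    \<le> (\<Sum>n\<in>squarefree_upto x. \<Sum>d | d dvd n \<and> real d \<le> real n powr (1 / real k). c ^ card (prime_factors d))"
proof -
  define z where "z = x powr (1 / real k)"
  let ?w = "\<lambda>d. c ^ card (prime_factors d)"
  let ?N = "\<lambda>d. {n \<in> squarefree_upto x. d dvd n \<and> real d \<le> real n powr (1 / real k)}"
  have z1: "z \<ge> 1" using x by (simp add: z_def ge_one_powr_ge_zero)
  have zk: "z ^ k = x" using x k z1 by (simp add: z_def powr_realpow[symmetric] powr_powr)
  have zx: "z \<le> x" using self_le_power[OF z1 k] zk by simp
  have zk1: "z * z ^ (k - 1) = x" using zk k by (simp add: power_eq_if)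
  have w: "?w d \<ge> 0" "?w d \<le> 1" for d using c by (auto intro: power_le_one)
  have sub: "squarefree_upto z \<subseteq> squarefree_upto x" by (rule squarefree_upto_mono) fact
  have low: "a * x * prime_weight c d - 12 * sqrt (x / real d) - z ^ (k - 1) \<le> ?w d * real (card (?N d))"
    if d: "d \<in> squarefree_upto z" for d
  proof -
    note dD = squarefree_uptoD[OF d]
    let ?A = "{n \<in> squarefree_upto x. d dvd n}" and ?B = "{n \<in> squarefree_upto x. d dvd n \<and> n < d ^ k}"
    have "?A \<subseteq> ?N d \<union> ?B"
    proof
      fix n assume n: "n \<in> ?A"
      show "n \<in> ?N d \<union> ?B"
      proof (cases "n < d ^ k")
        case False
        then have "real d ^ k \<le> real n" by (metis not_less of_nat_le_iff of_nat_power)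
        then have "(real d ^ k) powr (1 / real k) \<le> real n powr (1 / real k)"
          by (intro powr_mono2) auto
        also have "(real d ^ k) powr (1 / real k) = real d"
          using dD k by (simp add: powr_realpow[symmetric] powr_powr)
        finally show ?thesis using n by simp
      qed (use n in simp)
    qed
    then have "card ?A \<le> card (?N d \<union> ?B)" by (intro card_mono) auto
    also have "\<dots> \<le> card (?N d) + card ?B" by (rule card_Un_le)
    also have "\<dots> \<le> card (?N d) + d ^ (k - 1)"
      using card_multiples_below_power[of d k x] dD k by simp
    finally have "real (card ?A) \<le> real (card (?N d) + d ^ (k - 1))" by (rule of_nat_mono)
    then have "real (card ?A) \<le> real (card (?N d)) + real d ^ (k - 1)" by simp
    also have "real d ^ (k - 1) \<le> z ^ (k - 1)" using dD by (intro power_mono) auto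
    finally have "?w d * real (card ?A) \<le> ?w d * (real (card (?N d)) + z ^ (k - 1))"
      using w by (intro mult_left_mono) auto
    also have "\<dots> \<le> ?w d * real (card (?N d)) + z ^ (k - 1)"
      using w[of d] z1 mult_right_mono[of "?w d" 1 "z ^ (k - 1)"] by (simp add: distrib_left)
    finally have "?w d * real (card ?A) \<le> ?w d * real (card (?N d)) + z ^ (k - 1)" .
    moreover have "\<bar>?w d * real (card ?A) - a * x * prime_weight c d\<bar> \<le> 12 * sqrt (x / real d)"
      using x by (intro weighted_squarefree_multiples a c dD) auto
    ultimately show ?thesis by linarith
  qed
  have "real (card (squarefree_upto z)) * z ^ (k - 1) \<le> z * z ^ (k - 1)"
    using card_squarefree_upto_le[of z] z1 by (intro mult_right_mono) auto
  moreover have "(\<Sum>d\<in>squarefree_upto z. sqrt (x / real d)) \<le> 2 * x"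
  proof -
    have "(\<Sum>d\<in>squarefree_upto z. sqrt (x / real d)) \<le> (\<Sum>d\<in>squarefree_upto x. sqrt (x / real d))"
      using sub x by (intro sum_mono2) auto
    also have "\<dots> \<le> 2 * x" using x by (intro sum_squarefree_sqrt_le) auto
    finally show ?thesis .
  qed
  ultimately have "a * x * weight_sum c z - 25 * x \<le>
    a * x * weight_sum c z - 12 * (\<Sum>d\<in>squarefree_upto z. sqrt (x / real d)) - real (card (squarefree_upto z)) * z ^ (k - 1)"
    using zk1 by linarith
  also have "\<dots> = (\<Sum>d\<in>squarefree_upto z. a * x * prime_weight c d - 12 * sqrt (x / real d) - z ^ (k - 1))"
    by (simp add: sum_subtractf sum_distrib_left weight_sum_def)
  also have "\<dots> \<le> (\<Sum>d\<in>squarefree_upto z. ?w d * real (card (?N d)))"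
    by (rule sum_mono) (rule low)
  also have "\<dots> \<le> (\<Sum>d\<in>squarefree_upto x. ?w d * real (card (?N d)))"
    by (intro sum_mono2 sub mult_nonneg_nonneg w) auto
  also have "\<dots> = (\<Sum>n\<in>squarefree_upto x. \<Sum>d | d dvd n \<and> real d \<le> real n powr (1 / real k). ?w d)"
    by (rule sum_squarefree_divisors[symmetric])
  finally show ?thesis by (simp add: z_def)
qed

lemma powr_less_2:
  fixes k :: nat
  assumes "k \<ge> 2" "0 \<le> c" "c < 1 / (real k - 1)"
  shows "real k powr c < 2"
proof -
  have "k \<le> 2 ^ (k - 1)"
    using assms(1) less_exp[of "k - 1"] by linarith
  then have "real k \<le> real (2 ^ (k - 1))" by (rule of_nat_mono)
  then have "real k \<le> 2 ^ (k - 1)" by simp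
  then have "real k \<le> 2 powr (real k - 1)"
    using assms(1) by (simp add: powr_realpow[symmetric] of_nat_diff)
  then have "real k powr c \<le> (2 powr (real k - 1)) powr c"
    using assms by (intro powr_mono2) auto
  also have "\<dots> = 2 powr ((real k - 1) * c)" by (simp add: powr_powr)
  also have "\<dots> < 2 powr 1"
    using assms by (intro powr_less_mono) (auto simp: field_simps)
  finally show ?thesis by simp
qed

theorem theorem1p1:
  fixes k :: nat and c :: real and h :: "nat \<Rightarrow> real"
  assumes "k \<ge> 3"
    and "0 \<le> c" and "c < 1 / (real k - 1)"
    and "multiplicative_fun h"
    and "\<And>p. prime p \<Longrightarrow> h p = c"
  shows "\<exists>\<epsilon> :: real \<Rightarrow> real. (\<epsilon> \<longlongrightarrow> 0) at_top \<and>
    (\<forall>\<^sub>F x in at_top.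
      (\<Sum>n | n > 0 \<and> real n \<le> x. (moebius_mu n)\<^sup>2 * (\<Sum>d | d dvd n. h d))
      \<le> (2 + \<epsilon> x) *
        (\<Sum>n | n > 0 \<and> real n \<le> x. (moebius_mu n)\<^sup>2 *
           (\<Sum>d | d dvd n \<and> real d \<le> real n powr (1 / real k). h d)))"
proof -
  define T where "T = (\<lambda>x. \<Sum>n\<in>squarefree_upto x. \<Sum>d | d dvd n. c ^ card (prime_factors d))"
  define S where "S = (\<lambda>x. \<Sum>n\<in>squarefree_upto x.
    \<Sum>d | d dvd n \<and> real d \<le> real n powr (1 / real k). c ^ card (prime_factors d))"
  have h: "h d = c ^ card (prime_factors d)" if "n \<in> squarefree_upto x" "d dvd n" for n d x
    using multiplicative_fun_squarefree[OF assms(4,5)] squarefree_mono[OF that(2)] squarefree_uptoD(1)[OF that(1)]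
    by blast
  have T: "(\<Sum>n | n > 0 \<and> real n \<le> x. (moebius_mu n)\<^sup>2 * (\<Sum>d | d dvd n. h d)) = T x" for x
    unfolding sum_moebius_mu_squared T_def by (intro sum.cong refl) (auto simp: h)
  have S: "(\<Sum>n | n > 0 \<and> real n \<le> x. (moebius_mu n)\<^sup>2 *
      (\<Sum>d | d dvd n \<and> real d \<le> real n powr (1 / real k). h d)) = S x" for x
    unfolding sum_moebius_mu_squared S_def by (intro sum.cong refl) (auto simp: h)
  have "eventually (\<lambda>x. T x \<le> 2 * S x) at_top"
  proof (cases "c = 0")
    case True
    have "T x \<le> 2 * S x" for x
    proof -
      have "T x \<le> S x" unfolding T_def S_def
      proof (rule sum_mono)
        fix n assume n: "n \<in> squarefree_upto x"
        \<comment> \<open>With c = 0 the term d = 1 is 0 ^ 0 = 1, and every other divisor has a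
          prime factor and contributes 0; d = 1 always satisfies d <= n^(1/k).\<close>
        have "(\<Sum>d | d dvd n. c ^ card (prime_factors d)) = (\<Sum>d\<in>{1::nat}. c ^ card (prime_factors d))"
        proof (rule sum.mono_neutral_right)
          show "\<forall>d\<in>{d. d dvd n} - {1}. c ^ card (prime_factors d) = 0"
          proof
            fix d assume d: "d \<in> {d. d dvd n} - {1}"
            then obtain p where "prime p" "p dvd d" using prime_factor_nat[of d] by auto
            moreover have "d \<noteq> 0" using d squarefree_uptoD[OF n] by (intro notI) auto
            ultimately have "p \<in> prime_factors d" by (simp add: prime_factors_dvd)
            then have "card (prime_factors d) > 0" by (auto simp: card_gt_0_iff)
            then show "c ^ card (prime_factors d) = 0" using True by simp
          qed
        qed (use squarefree_uptoD[OF n] in auto)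
        also have "\<dots> \<le> (\<Sum>d | d dvd n \<and> real d \<le> real n powr (1 / real k). c ^ card (prime_factors d))"
          using squarefree_uptoD[OF n] assms(2)
          by (intro sum_mono2) (auto simp: ge_one_powr_ge_zero)
        finally show "(\<Sum>d | d dvd n. c ^ card (prime_factors d)) \<le>
          (\<Sum>d | d dvd n \<and> real d \<le> real n powr (1 / real k). c ^ card (prime_factors d))" .
      qed
      moreover have "S x \<ge> 0" unfolding S_def using assms(2) by (intro sum_nonneg) auto
      ultimately show ?thesis by simp
    qed
    then show ?thesis by simp
  next
    case False
    then have c: "c > 0" "c \<le> 1/2"
    proof -
      have "1 / (real k - 1) \<le> 1 / 2" using assms(1) by (intro divide_left_mono) auto
      then show "c \<le> 1/2" using assms(3) by linarith
    qed (use assms(2) False in simp)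
    obtain a where a: "a > 0" "a \<le> 3"
      "\<And>y. y \<ge> 0 \<Longrightarrow> \<bar>real (card (squarefree_upto y)) - a * y\<bar> \<le> 3 * sqrt y"
      using squarefree_density by blast
    have "real k powr c < 2" using assms(1-3) by (intro powr_less_2) auto
    then obtain lam where lam: "real k powr c < lam" "lam < 2" using dense by blast
    have "eventually (\<lambda>x. weight_sum c x \<le> lam * weight_sum c (x powr (1 / real k))) at_top"
      using c assms(1) lam by (intro weight_sum_ratio) auto
    moreover have "filterlim (\<lambda>x. x powr (1 / real k)) at_top at_top"
      using assms(1) by real_asymp
    then have "filterlim (\<lambda>x. weight_sum c (x powr (1 / real k))) at_top at_top"
      by (rule filterlim_compose[OF weight_sum_at_top[OF c(1)]])
    \<comment> \<open>With \<open>G\<close> taken at x^(1/k), 2 S - T is at least a x (2 - lam) G -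
      2 * 25 x - 24 x, which explains 74; the strict gap between \<open>lam\<close> and 2 makes the
      leading coefficient positive.\<close>
    then have "eventually (\<lambda>x. weight_sum c (x powr (1 / real k)) \<ge> 74 / (a * (2 - lam))) at_top"
      by (simp add: filterlim_at_top)
    ultimately show ?thesis using eventually_ge_at_top[of 1]
    proof eventually_elim
      case (elim x)
      let ?G = "weight_sum c (x powr (1 / real k))"
      have "74 \<le> a * (2 - lam) * ?G"
        using elim(2) a lam by (simp add: field_simps)
      then have "x * 74 \<le> x * (a * (2 - lam) * ?G)" using elim(3) by (intro mult_left_mono) auto
      moreover have "T x \<le> a * x * weight_sum c x + 24 * x"
        unfolding T_def using c elim(3) by (intro full_sum_upper a) auto
      moreover have "a * x * ?G - 25 * x \<le> S x"
        unfolding S_def using c elim(3) assms(1) by (intro small_sum_lower a) auto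
      moreover have "a * x * weight_sum c x \<le> a * x * (lam * ?G)"
        using elim a by (intro mult_left_mono) auto
      ultimately show ?case by (simp add: algebra_simps)
    qed
  qed
  then show ?thesis unfolding T S by (intro exI[of _ "\<lambda>_. 0"]) simp
qed

end
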